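(* Let $(F,\mathcal L)$ be a face-laminar pair and $\beta$ a parameter with $1\le\beta\le2n$ such that each $S\in\mathcal L$ with $|S|\le\beta$ is $F$-contractible, and let $H$ be the $(F,\mathcal L,\beta)$-contraction of $G$. Let $1\le\lambda\le2n$. If $H$ has no alternating circuit of node-weight at most $\lambda$, then there exists $w\in\mathcal W$ such that $H$ has no $\mathrm{Min}(F,w)$-respecting alternating circuit of node-weight at most $2\lambda$.
   Context: $G=(V,E)$ is a fixed undirected simple graph with $n$ vertices, $n$ sufficiently large. For $S\subseteq V$, $\delta(S)$ (resp. $E(S)$) is the set of edges with exactly one (resp. two) endpoints in $S$; $\mathbf 1_X$ is the indicator vector of $X\subseteq E$; $x(\delta(S))=\sum_{e\in\delta(S)}x_e$. $\mathrm{PM}=\{x\in\mathbb{R}^E:x(\delta(v))=1\ \forall v,\ x(\delta(S))\ge1\ \forall S\subseteq V\text{ odd},\ x\ge0\}$ is the perfect matching polytope; a face is a nonempty subset obtained by setting some of these inequalities to equality; a perfect matching is in $F$ if its indicator vector is. $\mathrm{supp}(F)=\{e:\exists x\in F,x_e>0\}$; $\mathrm{tight}(F)=\{S\subseteq V:|S|\text{ odd},x(\delta(S))=1\ \forall x\in F\}$; $\mathrm{Min}(F,w)=\arg\min\{\langle w,x\rangle:x\in F\}$. Fix a numbering $E=\{e_1,\dots,e_{|E|}\}$; $\mathcal W=\{w_k:k=2,\dots,n^{20}\}$ where $w_k(e_j)=(4n^2+1)^j\bmod k$. A family of vertex sets is laminar if no two members $S,T$ cross (i.e. not all of $S\cap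 T,S\setminus T,T\setminus S$ nonempty); all laminar families contain all singletons. A face-laminar pair $(F,\mathcal L)$ is a face $F$ with a laminar $\mathcal L\subseteq\mathrm{tight}(F)$. $S\in\mathrm{tight}(F)$ is $F$-contractible if for each $e\in\delta(S)$ no two perfect matchings in $F$ contain $e$ and differ on $E(S)$. The $(F,\mathcal L,\beta)$-contraction is the node-weighted multigraph whose nodes are the maximal sets of cardinality at most $\beta$ in $\mathcal L$ (node-weight = cardinality), and whose edges are the edges $e\in\mathrm{supp}(F)\setminus\bigcup_{T\in\mathcal L,|T|>\beta}\delta(T)$ not lying inside a single node, joining the nodes containing their endpoints; its edges are identified with their preimages in $E$. A cyclic walk $C=(e_0,\dots,e_{k-1})$ of even length $k$ has $\chi_C=\sum_i(-1)^i\mathbf 1_{e_i}$; it is an alternating circuit if $\chi_C\ne0$; its node-weight is the sum of node-weights of visited vertices with multiplicity. A vector $z\in\mathbb{Z}^{E(H)}$, viewed in $\mathbb{Z}^E$ (zero outside edges of $H$), respects a subface $F'\subseteq F$ if $\{e:z_e\ne0\}\subseteq\mathrm{supp}(F')$ and $\langle z,\mathbf 1_{\delta(S)}\rangle=0$ for every $S\in\mathrm{tight}(F')$ that is a union of node-sets of $H$. An alternating circuit $C$ in $H$ respects $F'$ if $\chi_C$ does. *)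

theory Defs
  imports Complex_Main "HOL-Library.Indicator_Function"
begin

text \<open>
  A vector indexed by the edge set \<open>E\<close> is a function on all edges; elements of the perfect
  matching polytope are normalised to vanish outside \<open>E\<close>, so that the indicator vector of
  \<open>X \<subseteq> E\<close> is \<open>indicator X\<close>.
\<close>

definition simple_graph :: "'a set \<Rightarrow> 'a set set \<Rightarrow> bool" where
  "simple_graph V E \<longleftrightarrow> finite V \<and> (\<forall>e\<in>E. e \<subseteq> V \<and> card e = 2)"

definition cut_edges :: "'a set set \<Rightarrow> 'a set \<Rightarrow> 'a set set" where
  "cut_edges E S = {e \<in> E. card (e \<inter> S) = 1}"

definition inner_edges :: "'a set set \<Rightarrow> 'a set \<Rightarrow> 'a set set" where
  "inner_edges E S = {e \<in> E. card (e \<inter> S) = 2}"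

definition edge_inner :: "'a set set \<Rightarrow> ('a set \<Rightarrow> 'r) \<Rightarrow> ('a set \<Rightarrow> 'r) \<Rightarrow> 'r::comm_semiring_1" where
  "edge_inner E x y = (\<Sum>e\<in>E. x e * y e)"

definition perfect_matching :: "'a set \<Rightarrow> 'a set set \<Rightarrow> 'a set set \<Rightarrow> bool" where
  "perfect_matching V E M \<longleftrightarrow> M \<subseteq> E \<and> (\<forall>v\<in>V. \<exists>!e. e \<in> M \<and> v \<in> e)"

definition PM :: "'a set \<Rightarrow> 'a set set \<Rightarrow> ('a set \<Rightarrow> real) set" where
  "PM V E = {x. (\<forall>e. e \<notin> E \<longrightarrow> x e = 0)
      \<and> (\<forall>v\<in>V. sum x (cut_edges E {v}) = 1)
      \<and> (\<forall>S\<subseteq>V. odd (card S) \<longrightarrow> sum x (cut_edges E S) \<ge> 1)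
      \<and> (\<forall>e\<in>E. x e \<ge> 0)}"

definition is_face :: "'a set \<Rightarrow> 'a set set \<Rightarrow> ('a set \<Rightarrow> real) set \<Rightarrow> bool" where
  "is_face V E F \<longleftrightarrow> F \<noteq> {} \<and>
    (\<exists>\<S> D. \<S> \<subseteq> {S. S \<subseteq> V \<and> odd (card S)} \<and> D \<subseteq> E \<and>
       F = {x \<in> PM V E. (\<forall>S\<in>\<S>. sum x (cut_edges E S) = 1) \<and> (\<forall>e\<in>D. x e = 0)})"

definition supp :: "'a set set \<Rightarrow> ('a set \<Rightarrow> real) set \<Rightarrow> 'a set set" where
  "supp E F = {e \<in> E. \<exists>x\<in>F. x e > 0}"

definition tight :: "'a set \<Rightarrow> 'a set set \<Rightarrow> ('a set \<Rightarrow> real) set \<Rightarrow> 'a set set" where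
  "tight V E F = {S. S \<subseteq> V \<and> odd (card S) \<and> (\<forall>x\<in>F. sum x (cut_edges E S) = 1)}"

definition Min_face ::
  "'a set set \<Rightarrow> ('a set \<Rightarrow> real) set \<Rightarrow> ('a set \<Rightarrow> real) \<Rightarrow> ('a set \<Rightarrow> real) set" where
  "Min_face E F w = {x \<in> F. \<forall>y\<in>F. edge_inner E w x \<le> edge_inner E w y}"

text \<open>The numbering of \<open>E\<close> is given by \<open>idx\<close>, where \<open>idx e = j\<close> means that \<open>e\<close> is the edge
  with number \<open>j\<close>.\<close>

definition weight_fun :: "nat \<Rightarrow> ('a set \<Rightarrow> nat) \<Rightarrow> nat \<Rightarrow> 'a set \<Rightarrow> real" where
  "weight_fun n idx k e = real ((4 * n\<^sup>2 + 1) ^ idx e mod k)"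

definition weight_family :: "nat \<Rightarrow> ('a set \<Rightarrow> nat) \<Rightarrow> ('a set \<Rightarrow> real) set" where
  "weight_family n idx = weight_fun n idx ` {2..n ^ 20}"

definition crossing :: "'a set \<Rightarrow> 'a set \<Rightarrow> bool" where
  "crossing S T \<longleftrightarrow> S \<inter> T \<noteq> {} \<and> S - T \<noteq> {} \<and> T - S \<noteq> {}"

definition laminar :: "'a set \<Rightarrow> 'a set set \<Rightarrow> bool" where
  "laminar V L \<longleftrightarrow> (\<forall>S\<in>L. S \<subseteq> V) \<and> (\<forall>v\<in>V. {v} \<in> L) \<and> (\<forall>S\<in>L. \<forall>T\<in>L. \<not> crossing S T)"

definition face_laminar_pair ::
  "'a set \<Rightarrow> 'a set set \<Rightarrow> ('a set \<Rightarrow> real) set \<Rightarrow> 'a set set \<Rightarrow> bool" where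
  "face_laminar_pair V E F L \<longleftrightarrow> is_face V E F \<and> laminar V L \<and> L \<subseteq> tight V E F"

definition contractible ::
  "'a set \<Rightarrow> 'a set set \<Rightarrow> ('a set \<Rightarrow> real) set \<Rightarrow> 'a set \<Rightarrow> bool" where
  "contractible V E F S \<longleftrightarrow> S \<in> tight V E F \<and>
    (\<forall>e\<in>cut_edges E S. \<not> (\<exists>M M'.
        perfect_matching V E M \<and> indicator M \<in> F \<and> e \<in> M \<and>
        perfect_matching V E M' \<and> indicator M' \<in> F \<and> e \<in> M' \<and>
        M \<inter> inner_edges E S \<noteq> M' \<inter> inner_edges E S))"

record ('n, 'e) multigraph =
  nodes :: "'n set"
  edges :: "'e set"
  ends :: "'e \<Rightarrow> 'n set"
  node_wt :: "'n \<Rightarrow> nat"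

definition contraction ::
  "'a set set \<Rightarrow> ('a set \<Rightarrow> real) set \<Rightarrow> 'a set set \<Rightarrow> real \<Rightarrow> ('a set, 'a set) multigraph" where
  "contraction E F L \<beta> =
    (let N = {S \<in> L. real (card S) \<le> \<beta> \<and>
                (\<forall>T\<in>L. real (card T) \<le> \<beta> \<and> S \<subseteq> T \<longrightarrow> T = S)}
     in \<lparr> nodes = N,
          edges = {e \<in> supp E F - (\<Union>T \<in> {T \<in> L. real (card T) > \<beta>}. cut_edges E T).
                     \<not> (\<exists>S\<in>N. e \<subseteq> S)},
          ends = (\<lambda>e. {S \<in> N. S \<inter> e \<noteq> {}}),
          node_wt = card \<rparr>)"

text \<open>A cyclic walk is given by its edges \<open>es\<close> together with the visited nodes \<open>vs\<close>: the
  \<open>i\<close>-th edge joins the \<open>i\<close>-th node to the cyclically next one.\<close>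

definition cyclic_walk :: "('n, 'e) multigraph \<Rightarrow> 'n list \<Rightarrow> 'e list \<Rightarrow> bool" where
  "cyclic_walk H vs es \<longleftrightarrow> length vs = length es \<and> set vs \<subseteq> nodes H \<and> set es \<subseteq> edges H \<and>
    (\<forall>i<length es. ends H (es ! i) = {vs ! i, vs ! (Suc i mod length es)})"

definition alt_vec :: "'e list \<Rightarrow> 'e \<Rightarrow> int" where
  "alt_vec es = (\<lambda>e. \<Sum>i<length es. (- 1) ^ i * indicator {es ! i} e)"

definition alternating_circuit :: "('n, 'e) multigraph \<Rightarrow> 'n list \<Rightarrow> 'e list \<Rightarrow> bool" where
  "alternating_circuit H vs es \<longleftrightarrow>
     cyclic_walk H vs es \<and> even (length es) \<and> alt_vec es \<noteq> (\<lambda>e. 0)"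

definition walk_weight :: "('n, 'e) multigraph \<Rightarrow> 'n list \<Rightarrow> nat" where
  "walk_weight H vs = sum_list (map (node_wt H) vs)"

definition respects_face ::
  "'a set \<Rightarrow> 'a set set \<Rightarrow> ('a set, 'a set) multigraph \<Rightarrow> ('a set \<Rightarrow> real) set
    \<Rightarrow> ('a set \<Rightarrow> int) \<Rightarrow> bool" where
  "respects_face V E H F' z \<longleftrightarrow> {e. z e \<noteq> 0} \<subseteq> supp E F' \<and>
     (\<forall>S\<in>tight V E F'. (\<exists>\<N>\<subseteq>nodes H. S = \<Union>\<N>) \<longrightarrow>
        edge_inner E z (indicator (cut_edges E S)) = 0)"

end

theory Submission
  imports Defs
begin

text \<open>
  Contractibility determines, for every edge \<open>e\<close> of \<open>H\<close>, the part of a matching through \<open>e\<close> inside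
  the two end nodes of \<open>e\<close>. Adding these parts lifts an alternating vector \<open>a\<close> of \<open>H\<close> to an integral
  vector \<open>z\<close> on \<open>E\<close>. If \<open>a\<close> respects \<open>Min(F, w)\<close>, then \<open>z\<close> is orthogonal to the cuts of all sets that
  are tight for \<open>Min(F, w)\<close>: for unions of nodes and for subsets of nodes this is immediate, and the
  other sets are uncrossed with nodes. So a relative interior point of \<open>Min(F, w)\<close> can be moved along
  \<open>z\<close> in both directions inside \<open>F\<close>, which forces \<open>\<langle>w, z\<rangle> = 0\<close>.

  Cut a circuit of node-weight at most \<open>2\<lambda>\<close> greedily into at most seven blocks of weight at most
  \<open>\<lambda>/2\<close> (or single nodes). The arcs joining the blocks and the parities of the block lengths determine
  \<open>a\<close>, because two different blocks with the same ends would form an alternating circuit of weight at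
  most \<open>\<lambda>\<close>. Hence only \<open>O(n^14)\<close> vectors \<open>z\<close> occur. Their values \<open>\<Sum> z e * (4n\<^sup>2+1)^idx e\<close> are
  nonzero, and their product is too small to be divisible by all \<open>k \<le> n^20\<close>.

  That every edge in the support of a face lies on a perfect matching of that face is Edmonds' theorem;
  it is proved in the qualitative form needed here, by contracting tight sets.
\<close>

section \<open>Edmonds' theorem for the support of a fractional perfect matching\<close>

text \<open>Respecting a face constrains a circuit only at tight sets that are unions of nodes,
  whereas tight sets of \<open>Min_face E F w\<close> may cut through nodes. Optimality of the face
  can therefore be exploited only after a lift to \<open>E\<close>. The lift must not depend on
  \<open>w\<close>, since the modulus \<open>k\<close> is chosen against integers fixed beforehand;
  this is why its matchings are taken in \<open>F\<close>.

  Origin of the constants: an entry of the lift is at most the circuit length, hence at most 2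
  lambda \<le> 4n, so entries are signed digits below the base B = 4n^2+1. The weights are powers of
  B reduced mod \<open>k\<close>, so orthogonality to them means that \<open>k\<close> divides the
  number with these digits. There are at most n^2 arcs, hence at most 8 (2n^2)^7 vectors, whose
  values have at most n (n^2+1) bits each. Together this is at most 2048 n^17 bits, while a common
  multiple of 2, ..., m is at least 2^m / 4. Blocks get weight lambda/2 so that two of them close up
  within lambda, while eight consecutive ones would exceed 2 lambda.\<close>

definition bcut :: "('e \<Rightarrow> 'v) \<Rightarrow> ('e \<Rightarrow> 'v) \<Rightarrow> 'e set \<Rightarrow> 'v set \<Rightarrow> 'e set" where
  "bcut h t E S = {e \<in> E. (h e \<in> S) \<noteq> (t e \<in> S)}"

text \<open>\<open>E\<close> is the support of \<open>x\<close>: strict positivity turns an edge set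
  of total weight 0 into the empty set. Edges are abstract with end maps \<open>h\<close> and
  \<open>t\<close>, because contraction creates parallel edges that must stay distinct.\<close>

definition frac_pm ::
  "('e \<Rightarrow> 'v) \<Rightarrow> ('e \<Rightarrow> 'v) \<Rightarrow> 'v set \<Rightarrow> 'e set \<Rightarrow> ('e \<Rightarrow> real) \<Rightarrow> bool" where
  "frac_pm h t V E x \<longleftrightarrow> finite V \<and> finite E \<and>
     (\<forall>e\<in>E. h e \<in> V \<and> t e \<in> V \<and> h e \<noteq> t e \<and> 0 < x e) \<and>
     (\<forall>v\<in>V. sum x (bcut h t E {v}) = 1) \<and>
     (\<forall>S\<subseteq>V. odd (card S) \<longrightarrow> 1 \<le> sum x (bcut h t E S))"

definition tight_odd ::
  "('e \<Rightarrow> 'v) \<Rightarrow> ('e \<Rightarrow> 'v) \<Rightarrow> 'v set \<Rightarrow> 'e set \<Rightarrow> ('e \<Rightarrow> real) \<Rightarrow> 'v set \<Rightarrow> bool" where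
  "tight_odd h t V E x S \<longleftrightarrow> S \<subseteq> V \<and> odd (card S) \<and> sum x (bcut h t E S) = 1"

lemma finite_bcut [simp]: "finite E \<Longrightarrow> finite (bcut h t E S)"
  by (simp add: bcut_def)

lemma sum_bcut:
  assumes "finite E"
  shows "sum x (bcut h t E S) = (\<Sum>e\<in>E. if (h e \<in> S) \<noteq> (t e \<in> S) then x e else 0)"
  using assms unfolding bcut_def by (simp add: sum.inter_filter)

lemma sum_indicator_card:
  "finite A \<Longrightarrow> (\<Sum>e\<in>A. indicator M e :: 'r::semiring_1) = of_nat (card (M \<inter> A))"
  by (simp add: indicator_def of_bool_def Int_def conj_commute flip: sum.inter_filter)

lemma bcut_complement:
  assumes "\<And>e. e \<in> E \<Longrightarrow> h e \<in> V \<and> t e \<in> V"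
  shows "bcut h t E (V - S) = bcut h t E S"
  using assms by (auto simp: bcut_def)

lemma sum_bcut_singletons:
  fixes x :: "'e \<Rightarrow> real"
  assumes "finite E" "finite S" "\<And>e. e \<in> E \<Longrightarrow> h e \<noteq> t e"
  shows "(\<Sum>v\<in>S. sum x (bcut h t E {v})) =
    sum x (bcut h t E S) + 2 * sum x {e \<in> E. h e \<in> S \<and> t e \<in> S}"
proof -
  have "(\<Sum>v\<in>S. sum x (bcut h t E {v})) =
    (\<Sum>e\<in>E. \<Sum>v\<in>S. if (h e \<in> {v}) \<noteq> (t e \<in> {v}) then x e else 0)"
    unfolding sum_bcut[OF assms(1)] by (rule sum.swap)
  also have "\<dots> = (\<Sum>e\<in>E. (if (h e \<in> S) \<noteq> (t e \<in> S) then x e else 0)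
      + 2 * (if h e \<in> S \<and> t e \<in> S then x e else 0))"
  proof (rule sum.cong[OF refl])
    fix e assume "e \<in> E"
    then have "(\<Sum>v\<in>S. if (h e \<in> {v}) \<noteq> (t e \<in> {v}) then x e else 0) =
      (\<Sum>v\<in>S. (if h e = v then x e else 0) + (if t e = v then x e else 0))"
      using assms(3) by (intro sum.cong) auto
    also have "\<dots> = (if h e \<in> S then x e else 0) + (if t e \<in> S then x e else 0)"
      using assms(2) by (simp add: sum.distrib)
    finally show "(\<Sum>v\<in>S. if (h e \<in> {v}) \<noteq> (t e \<in> {v}) then x e else 0) =
      (if (h e \<in> S) \<noteq> (t e \<in> S) then x e else 0)
      + 2 * (if h e \<in> S \<and> t e \<in> S then x e else 0)" by auto
  qed
  also have "\<dots> = sum x (bcut h t E S) + 2 * sum x {e \<in> E. h e \<in> S \<and> t e \<in> S}"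
    using assms(1) by (simp add: sum.distrib sum_bcut sum.inter_filter flip: sum_distrib_left)
  finally show ?thesis .
qed

section \<open>Uncrossing of tight odd sets\<close>

text \<open>An identity over any commutative ring, because it serves three vectors: the real point
  \<open>x\<close>, the integer indicator of a matching, and the integral lift of a circuit.\<close>

lemma sum_bcut_uncross_Int_Un:
  fixes x :: "'e \<Rightarrow> 'r::comm_ring_1"
  assumes "finite E"
  shows "sum x (bcut h t E S) + sum x (bcut h t E T) =
    sum x (bcut h t E (S \<inter> T)) + sum x (bcut h t E (S \<union> T)) +
    2 * sum x {e \<in> E. h e \<in> S - T \<and> t e \<in> T - S \<or> t e \<in> S - T \<and> h e \<in> T - S}"
  unfolding sum_bcut[OF assms] sum.inter_filter[OF assms] sum_distrib_left sum.distrib[symmetric]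
  by (rule sum.cong) auto

lemma sum_bcut_uncross_Diff:
  fixes x :: "'e \<Rightarrow> 'r::comm_ring_1"
  assumes "finite E"
  shows "sum x (bcut h t E S) + sum x (bcut h t E T) =
    sum x (bcut h t E (S - T)) + sum x (bcut h t E (T - S)) +
    2 * sum x {e \<in> E. h e \<in> S \<inter> T \<and> t e \<notin> S \<union> T \<or> t e \<in> S \<inter> T \<and> h e \<notin> S \<union> T}"
  unfolding sum_bcut[OF assms] sum.inter_filter[OF assms] sum_distrib_left sum.distrib[symmetric]
  by (rule sum.cong) auto

text \<open>The parity of the intersection decides which pair of new sets is odd. The two old cuts
  sum to 2 and each new one is at least 1, so both new cuts equal 1 and nothing is left for the
  correction term; by positivity no such edge exists.\<close>

lemma tight_odd_uncross:
  assumes G: "frac_pm h t V E x" and S: "tight_odd h t V E x S" and T: "tight_odd h t V E x T"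
  shows "odd (card (S \<inter> T)) \<Longrightarrow> tight_odd h t V E x (S \<inter> T) \<and> tight_odd h t V E x (S \<union> T) \<and>
      {e \<in> E. h e \<in> S - T \<and> t e \<in> T - S \<or> t e \<in> S - T \<and> h e \<in> T - S} = {}"
    and "even (card (S \<inter> T)) \<Longrightarrow> tight_odd h t V E x (S - T) \<and> tight_odd h t V E x (T - S) \<and>
      {e \<in> E. h e \<in> S \<inter> T \<and> t e \<notin> S \<union> T \<or> t e \<in> S \<inter> T \<and> h e \<notin> S \<union> T} = {}"
proof -
  have fin: "finite V" "finite E" and pos: "\<And>e. e \<in> E \<Longrightarrow> 0 < x e"
    and cut: "\<And>S. S \<subseteq> V \<Longrightarrow> odd (card S) \<Longrightarrow> 1 \<le> sum x (bcut h t E S)"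
    using G by (auto simp: frac_pm_def)
  have ST: "S \<subseteq> V" "odd (card S)" "sum x (bcut h t E S) = 1" 
    "T \<subseteq> V" "odd (card T)" "sum x (bcut h t E T) = 1"
    using S T by (auto simp: tight_odd_def)
  have finST: "finite S" "finite T"
    using ST fin finite_subset by auto
  have empty: "D = {}" if "D \<subseteq> E" "sum x D \<le> 0" for D
  proof (rule ccontr)
    assume "D \<noteq> {}"
    then have "0 < sum x D"
      using that(1) fin(2) pos by (intro sum_pos) (auto intro: finite_subset)
    then show False using that by simp
  qed
  have nonneg: "0 \<le> sum x D" if "D \<subseteq> E" for D
    using that pos by (intro sum_nonneg) (auto intro: less_imp_le)
  {
    assume odd: "odd (card (S \<inter> T))"
    have "card (S \<union> T) + card (S \<inter> T) = card S + card T"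
      using finST card_Un_Int[of S T] by simp
    then have "odd (card (S \<union> T))" using odd ST by presburger
    let ?D = "{e \<in> E. h e \<in> S - T \<and> t e \<in> T - S \<or> t e \<in> S - T \<and> h e \<in> T - S}"
    have c1: "1 \<le> sum x (bcut h t E (S \<inter> T))" using odd ST by (intro cut) auto
    have c2: "1 \<le> sum x (bcut h t E (S \<union> T))" using \<open>odd (card (S \<union> T))\<close> ST by (intro cut) auto
    have "0 \<le> sum x ?D" by (rule nonneg) auto
    then have "sum x ?D \<le> 0" "sum x (bcut h t E (S \<inter> T)) = 1" "sum x (bcut h t E (S \<union> T)) = 1"
      using sum_bcut_uncross_Int_Un[OF fin(2), of x h t S T] c1 c2 ST by linarith+
    moreover from this(1) have "?D = {}" by (intro empty) auto
    ultimately show "tight_odd h t V E x (S \<inter> T) \<and> tight_odd h t V E x (S \<union> T) \<and> ?D = {}"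
      using ST odd \<open>odd (card (S \<union> T))\<close> by (auto simp: tight_odd_def)
  }
  {
    assume even: "even (card (S \<inter> T))"
    have "card (S - T) + card (S \<inter> T) = card S" "card (T - S) + card (S \<inter> T) = card T"
      using finST card_Diff_subset_Int[of S T] card_Diff_subset_Int[of T S]
        card_mono[of S "S \<inter> T"] card_mono[of T "S \<inter> T"] by (simp_all add: Int_commute)
    then have odds: "odd (card (S - T))" "odd (card (T - S))" using even ST by presburger+
    let ?D = "{e \<in> E. h e \<in> S \<inter> T \<and> t e \<notin> S \<union> T \<or> t e \<in> S \<inter> T \<and> h e \<notin> S \<union> T}"
    have c1: "1 \<le> sum x (bcut h t E (S - T))" using odds ST by (intro cut) auto
    have c2: "1 \<le> sum x (bcut h t E (T - S))" using odds ST by (intro cut) auto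
    have "0 \<le> sum x ?D" by (rule nonneg) auto
    then have "sum x ?D \<le> 0" "sum x (bcut h t E (S - T)) = 1" "sum x (bcut h t E (T - S)) = 1"
      using sum_bcut_uncross_Diff[OF fin(2), of x h t S T] c1 c2 ST by linarith+
    moreover from this(1) have "?D = {}" by (intro empty) auto
    ultimately show "tight_odd h t V E x (S - T) \<and> tight_odd h t V E x (T - S) \<and> ?D = {}"
      using ST odds by (auto simp: tight_odd_def)
  }
qed

lemma even_card_frac_pm:
  assumes "frac_pm h t V E x"
  shows "even (card V)"
proof (rule ccontr)
  assume "odd (card V)"
  then have "1 \<le> sum x (bcut h t E V)" using assms by (auto simp: frac_pm_def)
  moreover have "bcut h t E V = {}" using assms by (auto simp: frac_pm_def bcut_def)
  ultimately show False by simp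
qed

lemma tight_odd_complement:
  assumes G: "frac_pm h t V E x" and S: "tight_odd h t V E x S"
  shows "tight_odd h t V E x (V - S)"
proof -
  have "finite V" "S \<subseteq> V" using G S by (auto simp: frac_pm_def tight_odd_def)
  then have "card (V - S) + card S = card V"
    by (simp add: card_Diff_subset card_mono finite_subset)
  then have "odd (card (V - S))"
    using even_card_frac_pm[OF G] S unfolding tight_odd_def by (metis even_add)
  moreover have "bcut h t E (V - S) = bcut h t E S"
    using G by (intro bcut_complement) (auto simp: frac_pm_def)
  ultimately show ?thesis using S by (auto simp: tight_odd_def)
qed

section \<open>Contracting a tight set and gluing two matchings\<close>

text \<open>The representative \<open>s\<close> stands for all of \<open>S\<close>. It gets degree 1
  since \<open>S\<close> is tight, and parities survive since \<open>card S\<close> is odd. A set of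
  the contraction containing \<open>s\<close> comes from its union with \<open>S\<close>, any other
  from itself, with the same cut.\<close>

lemma frac_pm_contract:
  assumes G: "frac_pm h t V E x" and S: "tight_odd h t V E x S" and s: "s \<in> S"
  defines "q \<equiv> \<lambda>v. if v \<in> S then s else v"
  defines "V' \<equiv> insert s (V - S)" and "E' \<equiv> {e \<in> E. \<not> (h e \<in> S \<and> t e \<in> S)}"
  shows "frac_pm (q \<circ> h) (q \<circ> t) V' E' x"
    and "\<And>T. T \<inter> S = {} \<Longrightarrow> bcut (q \<circ> h) (q \<circ> t) E' T = bcut h t E T"
    and "\<And>T. S \<subseteq> T \<Longrightarrow> bcut (q \<circ> h) (q \<circ> t) E' (insert s (T - S)) = bcut h t E T"
    and "\<And>T. S \<subseteq> T \<Longrightarrow> T \<subseteq> V \<Longrightarrow> odd (card (insert s (T - S))) \<longleftrightarrow> odd (card T)"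
proof -
  have fin: "finite V" "finite E" using G by (auto simp: frac_pm_def)
  have SV: "S \<subseteq> V" and oS: "odd (card S)" and cS: "sum x (bcut h t E S) = 1"
    using S by (auto simp: tight_odd_def)
  show c1: "bcut (q \<circ> h) (q \<circ> t) E' T = bcut h t E T" if "T \<inter> S = {}" for T
    using that s by (auto simp: bcut_def q_def E'_def)
  show c2: "bcut (q \<circ> h) (q \<circ> t) E' (insert s (T - S)) = bcut h t E T" if "S \<subseteq> T" for T
    using that s by (auto simp: bcut_def q_def E'_def)
  show par: "odd (card (insert s (T - S))) \<longleftrightarrow> odd (card T)" if "S \<subseteq> T" "T \<subseteq> V" for T
  proof -
    have "finite T" using that fin finite_subset by blast
    then have "card (insert s (T - S)) = Suc (card (T - S))" "card (T - S) + card S = card T"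
      using s that by (auto simp: card_Diff_subset card_mono finite_subset)
    then show ?thesis using oS by presburger
  qed
  have form: "\<exists>T'. T' \<subseteq> V \<and> bcut (q \<circ> h) (q \<circ> t) E' T = bcut h t E T' \<and>
      (odd (card T) \<longleftrightarrow> odd (card T'))" if "T \<subseteq> V'" for T
  proof (cases "s \<in> T")
    case True
    then have "T = insert s ((T \<union> S) - S)" using that s by (auto simp: V'_def)
    moreover have "T \<union> S \<subseteq> V" using that SV s by (auto simp: V'_def)
    ultimately show ?thesis
      using c2[of "T \<union> S"] par[of "T \<union> S"]
      by (intro exI[of _ "T \<union> S"]) auto
  next
    case False
    then have "T \<inter> S = {}" using that by (auto simp: V'_def)
    then show ?thesis using c1 that False by (intro exI[of _ T]) (auto simp: V'_def)
  qed
  have deg: "sum x (bcut (q \<circ> h) (q \<circ> t) E' {v}) = 1" if "v \<in> V'" for v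
  proof (cases "v = s")
    case True then show ?thesis using c2[of S] cS by simp
  next
    case False
    then have "v \<in> V - S" using that by (auto simp: V'_def)
    then show ?thesis using c1[of "{v}"] G by (auto simp: frac_pm_def)
  qed
  show "frac_pm (q \<circ> h) (q \<circ> t) V' E' x"
    unfolding frac_pm_def
  proof (intro conjI allI impI ballI)
    show "finite V'" "finite E'" using fin by (auto simp: V'_def E'_def)
    show "sum x (bcut (q \<circ> h) (q \<circ> t) E' {v}) = 1" if "v \<in> V'" for v
      using deg that .
    show "1 \<le> sum x (bcut (q \<circ> h) (q \<circ> t) E' T)" if "T \<subseteq> V'" "odd (card T)" for T
      using form[OF that(1)] that(2) G unfolding frac_pm_def by metis
  qed (use G s in \<open>auto simp: frac_pm_def V'_def E'_def q_def\<close>)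
qed

text \<open>Singletons are tight, so \<open>M\<close> is a perfect matching; the conditions at the
  other tight sets place it in the smallest face containing \<open>x\<close>.\<close>

definition pm_through ::
  "('e \<Rightarrow> 'v) \<Rightarrow> ('e \<Rightarrow> 'v) \<Rightarrow> 'v set \<Rightarrow> 'e set \<Rightarrow> ('e \<Rightarrow> real) \<Rightarrow> 'e \<Rightarrow> bool" where
  "pm_through h t V E x e \<longleftrightarrow>
     (\<exists>M\<subseteq>E. e \<in> M \<and> (\<forall>S. tight_odd h t V E x S \<longrightarrow> card (M \<inter> bcut h t E S) = 1))"

text \<open>One half of the gluing: the induction hypothesis for the graph with \<open>S\<close>
  contracted, translated back. \<open>card S \<ge> 2\<close> makes the vertex count drop. Only tight
  sets that do not split \<open>S\<close> survive contraction.\<close>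

lemma contraction_matching:
  fixes h t :: "'e \<Rightarrow> 'v"
  assumes G: "frac_pm h t V E x" and S: "tight_odd h t V E x S" and S2: "card S \<ge> 2"
    and e: "e \<in> E" "\<not> (h e \<in> S \<and> t e \<in> S)"
    and IH: "\<And>(h' :: 'e \<Rightarrow> 'v) t' V' E' x' e'. card V' + card E' < card V + card E \<Longrightarrow>
      frac_pm h' t' V' E' x' \<Longrightarrow> e' \<in> E' \<Longrightarrow> pm_through h' t' V' E' x' e'"
  obtains M where "M \<subseteq> E" "e \<in> M" "\<And>f. f \<in> M \<Longrightarrow> \<not> (h f \<in> S \<and> t f \<in> S)"
    "\<And>T. tight_odd h t V E x T \<Longrightarrow> T \<inter> S = {} \<or> S \<subseteq> T \<Longrightarrow> card (M \<inter> bcut h t E T) = 1"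
proof -
  have fin: "finite V" "finite E" using G by (auto simp: frac_pm_def)
  have SV: "S \<subseteq> V" using S by (auto simp: tight_odd_def)
  obtain s where s: "s \<in> S" using S2 by fastforce
  define q where "q = (\<lambda>v. if v \<in> S then s else v)"
  define V' where "V' = insert s (V - S)"
  define E' where "E' = {e \<in> E. \<not> (h e \<in> S \<and> t e \<in> S)}"
  note contract = frac_pm_contract[OF G S s, folded q_def V'_def E'_def]
  have "card V' = Suc (card V - card S)"
    using s fin SV by (simp add: V'_def card_Diff_subset finite_subset)
  moreover have "card S \<le> card V" using fin SV by (simp add: card_mono)
  moreover have "card E' \<le> card E" using fin by (auto simp: E'_def intro: card_mono)
  ultimately have "card V' + card E' < card V + card E" using S2 by linarith
  moreover have "e \<in> E'" using e by (simp add: E'_def)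
  ultimately have "pm_through (q \<circ> h) (q \<circ> t) V' E' x e" using IH contract(1) by blast
  then obtain M where M: "M \<subseteq> E'" "e \<in> M"
    "\<And>T. tight_odd (q \<circ> h) (q \<circ> t) V' E' x T \<Longrightarrow> card (M \<inter> bcut (q \<circ> h) (q \<circ> t) E' T) = 1"
    unfolding pm_through_def by blast
  show ?thesis
  proof (rule that[of M])
    show "M \<subseteq> E" "\<And>f. f \<in> M \<Longrightarrow> \<not> (h f \<in> S \<and> t f \<in> S)" using M(1) by (auto simp: E'_def)
    fix T assume T: "tight_odd h t V E x T" and "T \<inter> S = {} \<or> S \<subseteq> T"
    from this(2) show "card (M \<inter> bcut h t E T) = 1"
    proof
      assume "T \<inter> S = {}"
      moreover from this have "tight_odd (q \<circ> h) (q \<circ> t) V' E' x T"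
        using T contract(2)[of T] unfolding tight_odd_def V'_def by auto
      ultimately show ?thesis using M(3)[of T] contract(2)[of T] by simp
    next
      assume "S \<subseteq> T"
      moreover from this have "tight_odd (q \<circ> h) (q \<circ> t) V' E' x (insert s (T - S))"
        using T contract(3,4)[of T] unfolding tight_odd_def V'_def by auto
      ultimately show ?thesis using M(3) contract(3)[of T] by metis
    qed
  qed (use M in auto)
qed

text \<open>A matching \<open>M1\<close> through \<open>e\<close> with \<open>S\<close> contracted
  crosses \<open>S\<close> in a single edge \<open>f\<close>. A matching \<open>M2\<close> through
  \<open>f\<close> with the complement contracted crosses \<open>S\<close> only in \<open>f\<close>.
  They agree on the cut, so their union is the required matching.\<close>

lemma pm_through_glue:
  fixes h t :: "'e \<Rightarrow> 'v"
  assumes G: "frac_pm h t V E x" and S: "tight_odd h t V E x S" and S2: "card S \<ge> 2"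
    and S3: "card (V - S) \<ge> 2"
    and e: "e \<in> E" "\<not> (h e \<in> S \<and> t e \<in> S)"
    and IH: "\<And>(h' :: 'e \<Rightarrow> 'v) t' V' E' x' e'. card V' + card E' < card V + card E \<Longrightarrow>
      frac_pm h' t' V' E' x' \<Longrightarrow> e' \<in> E' \<Longrightarrow> pm_through h' t' V' E' x' e'"
  shows "pm_through h t V E x e"
proof -
  have fin: "finite V" "finite E" and hV: "\<And>e. e \<in> E \<Longrightarrow> h e \<in> V \<and> t e \<in> V"
    using G by (auto simp: frac_pm_def)
  have SV: "S \<subseteq> V" using S by (auto simp: tight_odd_def)
  obtain M1 where M1: "M1 \<subseteq> E" "e \<in> M1" "\<And>f. f \<in> M1 \<Longrightarrow> \<not> (h f \<in> S \<and> t f \<in> S)"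
    "\<And>T. tight_odd h t V E x T \<Longrightarrow> T \<inter> S = {} \<or> S \<subseteq> T \<Longrightarrow> card (M1 \<inter> bcut h t E T) = 1"
    using contraction_matching[OF G S S2 e IH] by blast
  obtain f where f: "M1 \<inter> bcut h t E S = {f}"
    using M1(4)[OF S] by (auto simp: card_1_singleton_iff)
  have f': "f \<in> E" "\<not> (h f \<in> V - S \<and> t f \<in> V - S)" using f by (auto simp: bcut_def)
  have S': "tight_odd h t V E x (V - S)" using tight_odd_complement[OF G S] .
  obtain M2 where M2: "M2 \<subseteq> E" "f \<in> M2" "\<And>f. f \<in> M2 \<Longrightarrow> \<not> (h f \<in> V - S \<and> t f \<in> V - S)"
    "\<And>T. tight_odd h t V E x T \<Longrightarrow> T \<inter> (V - S) = {} \<or> V - S \<subseteq> T \<Longrightarrow>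
      card (M2 \<inter> bcut h t E T) = 1"
    using contraction_matching[OF G S' S3 f' IH] by blast
  have "bcut h t E (V - S) = bcut h t E S" using hV by (rule bcut_complement)
  then obtain g where g: "M2 \<inter> bcut h t E S = {g}"
    using M2(4)[OF S'] by (auto simp: card_1_singleton_iff)
  moreover have "f \<in> M2 \<inter> bcut h t E S" using f M2(2) by auto
  ultimately have f2: "M2 \<inter> bcut h t E S = {f}" by auto
  have in1: "h g \<notin> S \<and> t g \<notin> S" if "g \<in> M1" "g \<noteq> f" for g
    using M1(1,3) f that by (auto simp: bcut_def)
  have in2: "h g \<in> S \<and> t g \<in> S" if "g \<in> M2" "g \<noteq> f" for g
    using M2(1,3) f2 that hV by (auto simp: bcut_def)
  let ?M = "M1 \<union> M2"
  have fM: "f \<in> M1" "f \<in> M2" using f f2 by auto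
  have out: "card (?M \<inter> bcut h t E T) = 1" if "tight_odd h t V E x T" "T \<inter> S = {} \<or> S \<subseteq> T" for T
  proof -
    have "?M \<inter> bcut h t E T = M1 \<inter> bcut h t E T"
      using that(2) in2 fM by (auto simp: bcut_def)
    then show ?thesis using M1(4) that by simp
  qed
  have inn: "card (?M \<inter> bcut h t E T) = 1" if "tight_odd h t V E x T" "T \<subseteq> S" for T
  proof -
    have "?M \<inter> bcut h t E T = M2 \<inter> bcut h t E T"
      using that(2) in1 fM by (auto simp: bcut_def)
    then show ?thesis using M2(4) that by auto
  qed
  \<comment> \<open>A set crossing \<open>S\<close> is uncrossed with it. No edge of
    \<open>E\<close> lies in the correction term, so the counts of the union obey the uncrossing
    identity exactly; three of the four are 1 by \<open>out\<close> and \<open>inn\<close>, hence so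
    is the fourth.\<close>
  have all: "card (?M \<inter> bcut h t E T) = 1" if T: "tight_odd h t V E x T" for T
  proof (cases "odd (card (S \<inter> T))")
    case True
    note u = tight_odd_uncross(1)[OF G S T True]
    have "int (card (?M \<inter> bcut h t E S)) + int (card (?M \<inter> bcut h t E T)) =
      int (card (?M \<inter> bcut h t E (S \<inter> T))) + int (card (?M \<inter> bcut h t E (S \<union> T)))"
      using sum_bcut_uncross_Int_Un[OF fin(2), of "indicator ?M :: _ \<Rightarrow> int" h t S T] fin(2)
      unfolding u[THEN conjunct2, THEN conjunct2] by (simp add: sum_indicator_card)
    then show ?thesis using out[OF S] inn[of "S \<inter> T"] out[of "S \<union> T"] u by simp
  next
    case False
    then have even: "even (card (S \<inter> T))" by simp
    note u = tight_odd_uncross(2)[OF G S T even]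
    have "int (card (?M \<inter> bcut h t E S)) + int (card (?M \<inter> bcut h t E T)) =
      int (card (?M \<inter> bcut h t E (S - T))) + int (card (?M \<inter> bcut h t E (T - S)))"
      using sum_bcut_uncross_Diff[OF fin(2), of "indicator ?M :: _ \<Rightarrow> int" h t S T] fin(2)
      unfolding u[THEN conjunct2, THEN conjunct2] by (simp add: sum_indicator_card)
    moreover have "(T - S) \<inter> S = {}" by blast
    ultimately show ?thesis using out[OF S] inn[of "S - T"] out[of "T - S"] u by simp
  qed
  show ?thesis unfolding pm_through_def
    using M1 M2 all by (intro exI[of _ ?M]) auto
qed

section \<open>Reductions by a unit edge or a kernel vector of the degree equations\<close>

text \<open>Gaussian elimination: equation \<open>v\<close> is used to eliminate the pivot variable
  \<open>p\<close>, which removes one equation and one variable from the system.\<close>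

lemma homogeneous_system_nontrivial:
  fixes A :: "'v \<Rightarrow> 'e \<Rightarrow> 'r::field"
  assumes "finite V" "finite E" "card V < card E"
  shows "\<exists>z. (\<exists>e\<in>E. z e \<noteq> 0) \<and> (\<forall>v\<in>V. (\<Sum>e\<in>E. A v e * z e) = 0)"
  using assms
proof (induction V arbitrary: E A rule: finite_induct)
  case empty
  then have "E \<noteq> {}" by auto
  then show ?case by (intro exI[of _ "\<lambda>_. 1"]) auto
next
  case (insert v V)
  show ?case
  proof (cases "\<forall>e\<in>E. A v e = 0")
    case True
    moreover obtain z where "\<exists>e\<in>E. z e \<noteq> 0" "\<forall>v\<in>V. (\<Sum>e\<in>E. A v e * z e) = 0"
      using insert.IH[of E A] insert.prems insert.hyps by (metis Suc_lessD card_insert_disjoint)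
    ultimately show ?thesis by (intro exI[of _ z]) auto
  next
    case False
    then obtain p where p: "p \<in> E" "A v p \<noteq> 0" by auto
    let ?E = "E - {p}"
    have "card V < card ?E" using insert p by simp
    then obtain z where z: "\<exists>e\<in>?E. z e \<noteq> 0"
      "\<And>u. u \<in> V \<Longrightarrow> (\<Sum>e\<in>?E. (A u e - A u p * A v e / A v p) * z e) = 0"
      using insert.IH[of ?E "\<lambda>u e. A u e - A u p * A v e / A v p"] insert.prems(1) by blast
    \<comment> \<open>The value at \<open>p\<close> is the one that solves equation
      \<open>v\<close>.\<close>
    define y where "y = z(p := - (\<Sum>e\<in>?E. A v e * z e) / A v p)"
    have sum_y: "(\<Sum>e\<in>E. A u e * y e) = A u p * y p + (\<Sum>e\<in>?E. A u e * z e)" for u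
    proof -
      have "(\<Sum>e\<in>?E. A u e * y e) = (\<Sum>e\<in>?E. A u e * z e)"
        by (rule sum.cong) (auto simp: y_def)
      then show ?thesis using sum.remove[OF insert.prems(1) p(1), of "\<lambda>e. A u e * y e"] by simp
    qed
    have "(\<Sum>e\<in>E. A u e * y e) = 0" if "u \<in> insert v V" for u
    proof (cases "u = v")
      case True
      then show ?thesis using p by (simp add: sum_y) (simp add: y_def)
    next
      case False
      then have "0 = (\<Sum>e\<in>?E. A u e * z e - A u p / A v p * (A v e * z e))"
        using z(2)[of u] that by (simp add: algebra_simps)
      also have "\<dots> = (\<Sum>e\<in>?E. A u e * z e) - A u p / A v p * (\<Sum>e\<in>?E. A v e * z e)"
        by (simp add: sum_subtractf sum_distrib_left)
      also have "\<dots> = (\<Sum>e\<in>E. A u e * y e)" unfolding sum_y by (simp add: y_def)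
      finally show ?thesis by simp
    qed
    moreover have "\<exists>e\<in>E. y e \<noteq> 0" using z(1) by (auto simp: y_def)
    ultimately show ?thesis by (intro exI[of _ y]) blast
  qed
qed

lemma sum_eq_1_imp_singleton:
  fixes x :: "'e \<Rightarrow> real"
  assumes "finite A" "\<And>e. e \<in> A \<Longrightarrow> 0 < x e" "sum x A = 1" "f \<in> A" "1 \<le> x f"
  shows "A = {f}"
proof (rule ccontr)
  assume "A \<noteq> {f}"
  then have "A - {f} \<noteq> {}" using assms(4) by auto
  then have "0 < sum x (A - {f})" using assms by (intro sum_pos) auto
  then show False using sum.remove[OF assms(1,4), of x] assms by simp
qed

text \<open>Such an edge exhausts the degree of both its ends, so it is the only edge there and can
  be deleted together with them. A tight cut containing \<open>f\<close> is just \<open>{f}\<close>.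
  Any other tight set contains both ends of \<open>f\<close> or neither, so it stays odd and keeps
  its cut.\<close>

lemma pm_through_unit_edge:
  fixes h t :: "'e \<Rightarrow> 'v"
  assumes G: "frac_pm h t V E x" and f: "f \<in> E" "1 \<le> x f" and e: "e \<in> E"
    and IH: "\<And>(h' :: 'e \<Rightarrow> 'v) t' V' E' x' e'. card V' + card E' < card V + card E \<Longrightarrow>
      frac_pm h' t' V' E' x' \<Longrightarrow> e' \<in> E' \<Longrightarrow> pm_through h' t' V' E' x' e'"
  shows "pm_through h t V E x e"
proof -
  have fin: "finite V" "finite E" and hV: "\<And>e. e \<in> E \<Longrightarrow> h e \<in> V \<and> t e \<in> V \<and> h e \<noteq> t e"
    and pos: "\<And>e. e \<in> E \<Longrightarrow> 0 < x e"
    and deg: "\<And>v. v \<in> V \<Longrightarrow> sum x (bcut h t E {v}) = 1"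
    using G by (auto simp: frac_pm_def)
  have only: "bcut h t E S = {f}" if "sum x (bcut h t E S) = 1" "f \<in> bcut h t E S" for S
    using that f fin pos by (intro sum_eq_1_imp_singleton[of _ x]) (auto simp: bcut_def)
  define V' where "V' = V - {h f, t f}"
  define E' where "E' = E - {f}"
  have "bcut h t E {h f} = {f}" "bcut h t E {t f} = {f}"
    by (rule only[OF deg]; use f hV[of f] in \<open>auto simp: bcut_def\<close>)+
  then have endf: "bcut h t E {v} = {f}" if "v \<in> {h f, t f}" for v using that by auto
  have inc: "g \<in> bcut h t E {h g}" "g \<in> bcut h t E {t g}" if "g \<in> E" for g
    using that hV[of g] by (auto simp: bcut_def)
  have E'V': "h g \<in> V'" "t g \<in> V'" if "g \<in> E'" for g
  proof -
    have g: "g \<in> E" "g \<noteq> f" using that by (auto simp: E'_def)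
    then have "h g \<notin> {h f, t f}" "t g \<notin> {h f, t f}"
      using endf[of "h g"] endf[of "t g"] inc[of g] by (metis singletonD)+
    then show "h g \<in> V'" "t g \<in> V'" using hV[of g] g by (auto simp: V'_def)
  qed
  have cut: "bcut h t E' (T - {h f, t f}) = bcut h t E T" if "f \<notin> bcut h t E T" for T
    using that E'V' f unfolding E'_def V'_def bcut_def by auto
  have cut': "bcut h t E' T = bcut h t E T" if "T \<subseteq> V'" for T
    using that f unfolding E'_def V'_def bcut_def by auto
  have G': "frac_pm h t V' E' x"
    unfolding frac_pm_def
  proof (intro conjI allI impI ballI)
    fix T assume "T \<subseteq> V'" "odd (card T)"
    then show "1 \<le> sum x (bcut h t E' T)"
      using cut'[of T] G by (auto simp: frac_pm_def V'_def)
  next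
    fix v assume "v \<in> V'"
    then show "sum x (bcut h t E' {v}) = 1" using cut'[of "{v}"] deg by (auto simp: V'_def)
  qed (use fin E'V' hV pos in \<open>auto simp: V'_def E'_def\<close>)
  have "card V' \<le> card V" using fin by (auto simp: V'_def intro: card_mono)
  moreover have "card E' < card E" using fin(2) f(1) unfolding E'_def by (rule card_Diff1_less)
  ultimately have less: "card V' + card E' < card V + card E" by linarith
  obtain M where M: "M \<subseteq> E'" "e = f \<or> e \<in> M"
    "\<And>T. tight_odd h t V' E' x T \<Longrightarrow> card (M \<inter> bcut h t E' T) = 1"
  \<comment> \<open>The induction hypothesis needs some edge to pass through. Without edges no set
    is tight, as every cut has value 0.\<close>
  proof (cases "E' = {}")
    case True
    then have "e = f" using e by (auto simp: E'_def)
    moreover have "\<not> tight_odd h t V' E' x T" for T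
      unfolding True by (simp add: tight_odd_def bcut_def)
    ultimately show ?thesis using that[of "{}"] by blast
  next
    case False
    then obtain e' where "e' \<in> E'" "e = f \<or> e' = e" using e by (auto simp: E'_def)
    then show ?thesis using IH[OF less G' \<open>e' \<in> E'\<close>] that unfolding pm_through_def by blast
  qed
  show ?thesis unfolding pm_through_def
  proof (intro exI[of _ "insert f M"] conjI allI impI)
    fix T assume T: "tight_odd h t V E x T"
    show "card (insert f M \<inter> bcut h t E T) = 1"
    proof (cases "f \<in> bcut h t E T")
      case True
      then have "bcut h t E T = {f}" using T by (intro only) (auto simp: tight_odd_def)
      then show ?thesis by simp
    next
      case False
      let ?T = "T - {h f, t f}"
      have cuteq: "bcut h t E' ?T = bcut h t E T" by (rule cut[OF False])
      have "finite T" using T fin finite_subset by (auto simp: tight_odd_def)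
      have "odd (card ?T)"
      proof (cases "h f \<in> T")
        case True
        then have "{h f, t f} \<subseteq> T" using False f by (auto simp: bcut_def)
        then have "card ?T + 2 = card T"
          using hV[OF f(1)] \<open>finite T\<close> card_mono[of T "{h f, t f}"] by (simp add: card_Diff_subset)
        then show ?thesis using T unfolding tight_odd_def by (metis even_add even_numeral)
      next
        case h: False
        then have "?T = T" using False f by (auto simp: bcut_def)
        then show ?thesis using T by (simp add: tight_odd_def)
      qed
      then have "tight_odd h t V' E' x ?T" using T cuteq by (auto simp: tight_odd_def V'_def)
      then have "card (M \<inter> bcut h t E T) = 1" using M(3) cuteq by metis
      then show ?thesis using False by simp
    qed
  qed (use M f in \<open>auto simp: E'_def\<close>)
qed

text \<open>Gluing asks that \<open>e\<close> does not lie inside the contracted set; if it lies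
  inside \<open>S\<close>, the complement, which is tight too, takes the place of
  \<open>S\<close>.\<close>

lemma pm_through_nontrivial_tight:
  fixes h t :: "'e \<Rightarrow> 'v"
  assumes G: "frac_pm h t V E x" and S: "tight_odd h t V E x S" and S2: "card S \<ge> 2"
    and S3: "card (V - S) \<ge> 2" and e: "e \<in> E"
    and IH: "\<And>(h' :: 'e \<Rightarrow> 'v) t' V' E' x' e'. card V' + card E' < card V + card E \<Longrightarrow>
      frac_pm h' t' V' E' x' \<Longrightarrow> e' \<in> E' \<Longrightarrow> pm_through h' t' V' E' x' e'"
  shows "pm_through h t V E x e"
proof (cases "h e \<in> S \<and> t e \<in> S")
  case True
  have "V - (V - S) = S" using S by (auto simp: tight_odd_def)
  then show ?thesis
    using pm_through_glue[OF G tight_odd_complement[OF G S] S3 _ e _ IH] True S2 by simp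
next
  case False
  then show ?thesis using pm_through_glue[OF G S S2 S3 e _ IH] by blast
qed

text \<open>Along \<open>z\<close> the point moves until an edge vanishes or an odd cut becomes tight; since
  \<open>z e \<ge> 0\<close>, the edge \<open>e\<close> survives.\<close>

lemma pm_through_perturb:
  fixes h t :: "'e \<Rightarrow> 'v" and z :: "'e \<Rightarrow> real"
  assumes G: "frac_pm h t V E x"
    and triv: "\<And>S. tight_odd h t V E x S \<Longrightarrow> card S < 2 \<or> card (V - S) < 2"
    and z: "\<exists>e\<in>E. z e \<noteq> 0" "\<And>v. v \<in> V \<Longrightarrow> sum z (bcut h t E {v}) = 0"
    and e: "e \<in> E" and ze: "0 \<le> z e"
    and IH: "\<And>(h' :: 'e \<Rightarrow> 'v) t' V' E' x' e'. card V' + card E' < card V + card E \<Longrightarrow>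
      frac_pm h' t' V' E' x' \<Longrightarrow> e' \<in> E' \<Longrightarrow> pm_through h' t' V' E' x' e'"
  shows "pm_through h t V E x e"
proof -
  have fin: "finite V" "finite E" and hV: "\<And>e. e \<in> E \<Longrightarrow> h e \<in> V \<and> t e \<in> V \<and> h e \<noteq> t e"
    and pos: "\<And>e. e \<in> E \<Longrightarrow> 0 < x e"
    and deg: "\<And>v. v \<in> V \<Longrightarrow> sum x (bcut h t E {v}) = 1"
    and cut: "\<And>S. S \<subseteq> V \<Longrightarrow> odd (card S) \<Longrightarrow> 1 \<le> sum x (bcut h t E S)"
    using G by (auto simp: frac_pm_def)
  \<comment> \<open>The cut of a trivial odd set is the cut of a single vertex, possibly after
    complementing, and \<open>z\<close> has degree 0 at each vertex.\<close>
  have small: "sum z (bcut h t E S) = 0" if "S \<subseteq> V" "odd (card S)" "card S < 2 \<or> card (V - S) < 2" for S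
  proof -
    have "card (V - S) + card S = card V"
      using that(1) fin by (simp add: card_Diff_subset card_mono finite_subset)
    then have "odd (card (V - S))" using even_card_frac_pm[OF G] that(2) by (metis even_add)
    then have "card S = 1 \<or> card (V - S) = 1" using that(2,3) by (auto simp: less_2_cases_iff)
    then show ?thesis
    proof
      assume "card S = 1"
      then show ?thesis using z(2) that(1) by (auto simp: card_1_singleton_iff)
    next
      assume "card (V - S) = 1"
      then have "sum z (bcut h t E (V - S)) = 0" using z(2) by (metis DiffD1 card_1_singletonE insertI1)
      then show ?thesis using bcut_complement[of E h V t S] hV by simp
    qed
  qed
  have "\<exists>e\<in>E. z e < 0"
  proof (rule ccontr)
    assume "\<not> ?thesis"
    then have nn: "\<And>e. e \<in> E \<Longrightarrow> 0 \<le> z e" by force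
    obtain g where g: "g \<in> E" "z g \<noteq> 0" using z(1) by auto
    then have "g \<in> bcut h t E {h g}" using hV[of g] by (auto simp: bcut_def)
    moreover have "sum z (bcut h t E {h g}) = 0" using z(2) hV g by auto
    ultimately have "z g = 0"
      using nn fin by (subst (asm) sum_nonneg_eq_0_iff) (auto simp: bcut_def)
    then show False using g by simp
  qed
  define NE where "NE = {e \<in> E. z e < 0}"
  define NS where "NS = {S. S \<subseteq> V \<and> odd (card S) \<and> sum z (bcut h t E S) < 0}"
  \<comment> \<open>The step lengths at which an edge value reaches 0 or an odd cut reaches 1. The
    set is nonempty because a nonzero \<open>z\<close> with zero degrees has a negative
    entry.\<close>
  define C where "C = (\<lambda>e. x e / (- z e)) ` NE \<union>
    (\<lambda>S. (sum x (bcut h t E S) - 1) / (- sum z (bcut h t E S))) ` NS"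
  have C: "finite C" "C \<noteq> {}"
    using fin \<open>\<exists>e\<in>E. z e < 0\<close> by (auto simp: C_def NE_def NS_def)
  define \<tau> where "\<tau> = Min C"
  have "\<tau> \<in> C" using C by (simp add: \<tau>_def)
  have \<tau>le: "\<tau> \<le> c" if "c \<in> C" for c using that C by (simp add: \<tau>_def)
  have "0 \<le> \<tau>"
    using \<open>\<tau> \<in> C\<close> pos cut unfolding C_def NE_def NS_def
    by (auto intro!: divide_nonneg_pos divide_nonneg_neg simp del: divide_minus_right intro: less_imp_le)
  define x' where "x' = (\<lambda>e. x e + \<tau> * z e)"
  define E' where "E' = {e \<in> E. 0 < x' e}"
  have x'nn: "0 \<le> x' g" if "g \<in> E" for g
  proof (cases "z g < 0")
    case True
    then have "\<tau> \<le> x g / (- z g)" using that by (intro \<tau>le) (auto simp: C_def NE_def)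
    then show ?thesis using True by (simp add: x'_def field_simps)
  next
    case False
    then show ?thesis using pos[OF that] \<open>0 \<le> \<tau>\<close> by (simp add: x'_def add_nonneg_nonneg)
  qed
  have sum_x': "sum x' (bcut h t E S) = sum x (bcut h t E S) + \<tau> * sum z (bcut h t E S)" for S
    by (simp add: x'_def sum.distrib sum_distrib_left)
  have sum_E': "sum x' (bcut h t E' S) = sum x' (bcut h t E S)" for S
    using fin x'nn by (intro sum.mono_neutral_left) (auto simp: bcut_def E'_def order.strict_iff_order)
  have cut': "1 \<le> sum x' (bcut h t E S)" if "S \<subseteq> V" "odd (card S)" for S
  proof (cases "sum z (bcut h t E S) < 0")
    case True
    then have "\<tau> \<le> (sum x (bcut h t E S) - 1) / (- sum z (bcut h t E S))"
      using that by (intro \<tau>le) (auto simp: C_def NS_def)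
    then show ?thesis using True by (simp add: sum_x' field_simps)
  next
    case False
    then have "0 \<le> \<tau> * sum z (bcut h t E S)" using \<open>0 \<le> \<tau>\<close> by simp
    then show ?thesis using cut[OF that] by (simp add: sum_x')
  qed
  have G': "frac_pm h t V E' x'"
    unfolding frac_pm_def sum_E' using fin hV cut' by (auto simp: E'_def sum_x' deg z(2))
  \<comment> \<open>All sets tight for \<open>x\<close> are trivial, so \<open>z\<close> does not
    change their cuts. A matching found for the new point therefore serves for \<open>x\<close> as
    well.\<close>
  have tight': "tight_odd h t V E' x' S" if "tight_odd h t V E x S" for S
    using that triv[OF that] small[of S] unfolding tight_odd_def sum_E' by (auto simp: sum_x')
  have eE': "e \<in> E'"
    using e ze \<open>0 \<le> \<tau>\<close> pos[OF e] by (auto simp: E'_def x'_def intro: add_pos_nonneg)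
  have "pm_through h t V E' x' e"
  proof (cases "E' = E")
    case False
    then have "card E' < card E" using fin by (auto simp: E'_def intro: psubset_card_mono)
    then show ?thesis using IH[OF _ G' eE'] by simp
  next
    \<comment> \<open>No edge has vanished, so the minimum is attained at an odd cut on which
      \<open>z\<close> has negative sum. By \<open>small\<close> that set is nontrivial, and it is
      tight for the new point; its contraction reduces the size.\<close>
    case True
    have "\<tau> \<notin> (\<lambda>e. x e / (- z e)) ` NE"
    proof
      assume "\<tau> \<in> (\<lambda>e. x e / (- z e)) ` NE"
      then obtain g where "g \<in> E" "z g < 0" "\<tau> = x g / (- z g)" by (auto simp: NE_def)
      then have "g \<notin> E'" by (simp add: E'_def x'_def)
      then show False using True \<open>g \<in> E\<close> by simp
    qed
    then obtain S where S: "S \<subseteq> V" "odd (card S)" "sum z (bcut h t E S) < 0"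
      "\<tau> = (sum x (bcut h t E S) - 1) / (- sum z (bcut h t E S))"
      using \<open>\<tau> \<in> C\<close> unfolding C_def NS_def by blast
    then have "sum x' (bcut h t E' S) = 1" by (simp add: sum_E' sum_x')
    then have "tight_odd h t V E' x' S" using S by (simp add: tight_odd_def)
    moreover have "2 \<le> card S" "2 \<le> card (V - S)" using small[OF S(1,2)] S(3) by force+
    ultimately show ?thesis
      using pm_through_nontrivial_tight[OF G' _ _ _ eE' IH] True by blast
  qed
  then obtain M where M: "M \<subseteq> E'" "e \<in> M"
    "\<And>S. tight_odd h t V E' x' S \<Longrightarrow> card (M \<inter> bcut h t E' S) = 1"
    unfolding pm_through_def by blast
  moreover have "M \<inter> bcut h t E' S = M \<inter> bcut h t E S" for S
    using M(1) by (auto simp: bcut_def E'_def)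
  ultimately show ?thesis
    using tight' unfolding pm_through_def by (intro exI[of _ M]) (auto simp: E'_def)
qed

text \<open>Counting gives a kernel vector once all degrees are at least three. A vertex of degree two
  with distinct neighbours forms with them a tight set of size three, which leaves only the
  four-cycle.\<close>

lemma degree_kernel_nontrivial:
  assumes G: "frac_pm h t V E x" and lt1: "\<And>f. f \<in> E \<Longrightarrow> x f < 1"
    and triv: "\<And>S. tight_odd h t V E x S \<Longrightarrow> card S < 2 \<or> card (V - S) < 2"
    and "E \<noteq> {}"
  shows "\<exists>z :: 'e \<Rightarrow> real. (\<exists>e\<in>E. z e \<noteq> 0) \<and> (\<forall>v\<in>V. sum z (bcut h t E {v}) = 0)"
proof -
  have fin: "finite V" "finite E" and hV: "\<And>e. e \<in> E \<Longrightarrow> h e \<in> V \<and> t e \<in> V \<and> h e \<noteq> t e"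
    and pos: "\<And>e. e \<in> E \<Longrightarrow> 0 < x e"
    and deg: "\<And>v. v \<in> V \<Longrightarrow> sum x (bcut h t E {v}) = 1"
    and cut: "\<And>S. S \<subseteq> V \<Longrightarrow> odd (card S) \<Longrightarrow> 1 \<le> sum x (bcut h t E S)"
    using G by (auto simp: frac_pm_def)
  have inc: "e \<in> bcut h t E {v} \<longleftrightarrow> e \<in> E \<and> v \<in> {h e, t e}" for e v
    using hV by (fastforce simp: bcut_def)
  have deg2: "2 \<le> card (bcut h t E {v})" if "v \<in> V" for v
  proof (rule ccontr)
    assume "\<not> ?thesis"
    then have "card (bcut h t E {v}) = 0 \<or> card (bcut h t E {v}) = 1" by linarith
    then show False
    proof
      assume "card (bcut h t E {v}) = 0"
      then have "bcut h t E {v} = {}" using fin by simp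
      then show False using deg[OF that] by simp
    next
      assume "card (bcut h t E {v}) = 1"
      then obtain e where "bcut h t E {v} = {e}" by (auto simp: card_1_singleton_iff)
      then have "x e = 1" "e \<in> E" using deg[OF that] inc by auto
      then show False using lt1[of e] by simp
    qed
  qed
  show ?thesis
  proof (cases "\<exists>e\<in>E. \<exists>f\<in>E. e \<noteq> f \<and> {h e, t e} = {h f, t f}")
    case True
    then obtain e f where ef: "e \<in> E" "f \<in> E" "e \<noteq> f" "{h e, t e} = {h f, t f}" by auto
    define z where "z = (\<lambda>g. (if g = e then 1 else 0) - (if g = f then 1 else 0 :: real))"
    have "sum z (bcut h t E {v}) = 0" for v
      using fin ef by (simp add: z_def sum_subtractf inc)
    moreover have "z e \<noteq> 0" using ef by (simp add: z_def)
    ultimately show ?thesis using ef by blast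
  next
    case noparallel: False
    show ?thesis
    proof (cases "\<forall>v\<in>V. 3 \<le> card (bcut h t E {v})")
      case True
      \<comment> \<open>Degree counting: 3 |V| \<le> 2 |E|, so there are fewer degree equations than
        edges.\<close>
      have "bcut h t E V = {}" "{e \<in> E. h e \<in> V \<and> t e \<in> V} = E"
        using hV by (auto simp: bcut_def)
      then have "(\<Sum>v\<in>V. real (card (bcut h t E {v}))) = 2 * real (card E)"
        using sum_bcut_singletons[of E V h t "\<lambda>_. 1"] fin hV by simp
      moreover have "(\<Sum>v\<in>V. 3) \<le> (\<Sum>v\<in>V. real (card (bcut h t E {v})))"
        using True by (intro sum_mono) force
      ultimately have "3 * card V \<le> 2 * card E" by simp
      moreover have "0 < card E" using fin \<open>E \<noteq> {}\<close> by (simp add: card_gt_0_iff)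
      ultimately have "card V < card E" by linarith
      from homogeneous_system_nontrivial[OF fin this,
          of "\<lambda>v e. if (h e \<in> {v}) \<noteq> (t e \<in> {v}) then 1 else 0 :: real"]
      show ?thesis unfolding sum_bcut[OF fin(2)] by (simp add: if_distrib[of "\<lambda>a. a * _"] cong: if_cong)
    next
      case False
      then obtain v where v: "v \<in> V" "\<not> 3 \<le> card (bcut h t E {v})" by auto
      then have "card (bcut h t E {v}) = 2" using deg2[OF v(1)] by linarith
      then obtain e f where ef: "bcut h t E {v} = {e, f}" "e \<noteq> f" by (auto simp: card_2_iff)
      have other: "\<exists>b. {h g, t g} = {u, b} \<and> b \<noteq> u \<and> b \<in> V" if "g \<in> bcut h t E {u}" for g u
      proof -
        have "g \<in> E" "u = h g \<or> u = t g" using that unfolding inc by auto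
        then show ?thesis
          using hV[of g] by (elim disjE) (metis insert_commute)+
      qed
      obtain a where a: "{h e, t e} = {v, a}" "a \<noteq> v" "a \<in> V" using other[of e v] ef by auto
      obtain b where b: "{h f, t f} = {v, b}" "b \<noteq> v" "b \<in> V" using other[of f v] ef by auto
      have efE: "e \<in> E" "f \<in> E" using ef inc by auto
      have "a \<noteq> b" using noparallel a b ef efE by metis
      \<comment> \<open>The three degrees sum to 3. The edges \<open>e\<close> and \<open>f\<close>
        inside carry the whole degree 1 of \<open>v\<close> and count twice, so the cut has value at
        most 1, hence exactly 1.\<close>
      let ?S = "{a, v, b}"
      have cS: "card ?S = 3" "?S \<subseteq> V" using a b v \<open>a \<noteq> b\<close> by auto
      have "(\<Sum>v\<in>?S. sum x (bcut h t E {v})) = 3" using cS a b v \<open>a \<noteq> b\<close> by (simp add: deg)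
      then have "3 = sum x (bcut h t E ?S) + 2 * sum x {e \<in> E. h e \<in> ?S \<and> t e \<in> ?S}"
        using sum_bcut_singletons[of E ?S h t x] fin hV by simp
      moreover have "sum x {e, f} \<le> sum x {e \<in> E. h e \<in> ?S \<and> t e \<in> ?S}"
        using fin efE a b pos by (intro sum_mono2) (auto intro: less_imp_le)
      moreover have "sum x {e, f} = 1" using deg[OF v(1)] ef by simp
      moreover have "1 \<le> sum x (bcut h t E ?S)" using cS by (intro cut) auto
      ultimately have "tight_odd h t V E x ?S" unfolding tight_odd_def using cS by auto
      then have "card (V - ?S) < 2" using triv cS by fastforce
      moreover have "card (V - ?S) + 3 = card V"
        using cS fin by (metis card_Diff_subset card_mono finite_subset le_add_diff_inverse2)
      then have "odd (card (V - ?S))" using even_card_frac_pm[OF G] by (metis even_add odd_numeral)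
      ultimately have "card (V - ?S) = 1" by (auto simp: less_2_cases_iff)
      then obtain w where w: "V - ?S = {w}" by (auto simp: card_1_singleton_iff)
      then have wV: "w \<in> V" "w \<noteq> a" "w \<noteq> b" "w \<noteq> v" and V4: "V = {a, v, b, w}"
        using a b v by auto
      \<comment> \<open>The only edges at \<open>v\<close> are \<open>e\<close> and
        \<open>f\<close>, which lead to \<open>a\<close> and \<open>b\<close>; so the edges at
        \<open>w\<close> end in \<open>a\<close> or \<open>b\<close>.\<close>
      have wnb: "{h g, t g} = {w, a} \<or> {h g, t g} = {w, b}" if gw: "g \<in> bcut h t E {w}" for g
      proof -
        obtain c where c: "{h g, t g} = {w, c}" "c \<noteq> w" "c \<in> V" using other[OF gw] by auto
        have "c \<noteq> v"
        proof
          assume "c = v"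
          then have "g \<in> bcut h t E {v}" using gw c unfolding inc by auto
          then have "g = e \<or> g = f" using ef by auto
          then have "w \<in> {v, a, b}" using c a b by blast
          then show False using wV by auto
        qed
        then show ?thesis using c V4 by auto
      qed
      obtain g1 g2 where g12: "g1 \<in> bcut h t E {w}" "g2 \<in> bcut h t E {w}" "g1 \<noteq> g2"
        using deg2[OF wV(1)] fin by (metis card_le_Suc0_iff_eq finite_bcut not_less_eq_eq numeral_2_eq_2)
      have gE: "g1 \<in> E" "g2 \<in> E" using g12 inc by auto
      have "\<exists>g g'. g \<in> E \<and> g' \<in> E \<and> {h g, t g} = {w, a} \<and> {h g', t g'} = {w, b}"
        using wnb[OF g12(1)] wnb[OF g12(2)] noparallel g12(3) gE by metis
      then obtain g g' where g: "g \<in> E" "g' \<in> E" "{h g, t g} = {w, a}" "{h g', t g'} = {w, b}"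
        by auto
      \<comment> \<open>Alternating signs along the four-cycle v, a, w, b with edges
        \<open>e\<close>, \<open>g\<close>, \<open>g'\<close>, \<open>f\<close>.\<close>
      define z where "z = (\<lambda>k. (if k = e then 1 else 0) - (if k = f then 1 else 0 :: real)
        + (if k = g' then 1 else 0) - (if k = g then 1 else 0))"
      have "sum z (bcut h t E {u}) = 0" if "u \<in> V" for u
      proof -
        have "sum z (bcut h t E {u}) = (if u \<in> {h e, t e} then 1 else 0) -
          (if u \<in> {h f, t f} then 1 else 0) + (if u \<in> {h g', t g'} then 1 else 0) -
          (if u \<in> {h g, t g} then 1 else 0)"
          using fin efE g(1,2) by (simp add: z_def sum_subtractf sum.distrib inc del: insert_iff)
        then show ?thesis using that a(2) b(2) wV \<open>a \<noteq> b\<close> unfolding V4 a(1) b(1) g(3,4) by auto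
      qed
      moreover have "e \<noteq> g" "e \<noteq> g'" using g a wV by blast+
      then have "z e \<noteq> 0" using ef by (simp add: z_def)
      ultimately show ?thesis using efE by blast
    qed
  qed
qed

lemma edmonds_matching_through_edge:
  assumes "frac_pm h t V E x" "e \<in> E"
  shows "pm_through h t V E x e"
  using assms
proof (induction "card V + card E" arbitrary: h t V E x e rule: less_induct)
  case less
  note G = less.prems(1) and e = less.prems(2) and IH = less.hyps
  show ?case
  proof (cases "\<exists>S. tight_odd h t V E x S \<and> 2 \<le> card S \<and> 2 \<le> card (V - S)")
    case True
    then show ?thesis using pm_through_nontrivial_tight[OF G _ _ _ e IH] by blast
  next
    case triv: False
    show ?thesis
    proof (cases "\<exists>f\<in>E. 1 \<le> x f")
      case True
      then show ?thesis using pm_through_unit_edge[OF G _ _ e IH] by blast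
    next
      case False
      obtain z :: "_ \<Rightarrow> real" where z: "\<exists>e\<in>E. z e \<noteq> 0" "\<And>v. v \<in> V \<Longrightarrow> sum z (bcut h t E {v}) = 0"
        using degree_kernel_nontrivial[OF G] False triv e by (metis empty_iff not_le)
      \<comment> \<open>The perturbation must not decrease the value at \<open>e\<close>; one of
        \<open>z\<close> and \<open>- z\<close> qualifies.\<close>
      have z': "\<exists>e\<in>E. - z e \<noteq> 0" "\<And>v. v \<in> V \<Longrightarrow> sum (\<lambda>e. - z e) (bcut h t E {v}) = 0"
        using z by (auto simp: sum_negf)
      have tr: "card S < 2 \<or> card (V - S) < 2" if "tight_odd h t V E x S" for S
        using triv that by force
      show ?thesis
        using pm_through_perturb[OF G tr z e _ IH] pm_through_perturb[OF G tr z' e _ IH]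
        by (cases "0 \<le> z e") auto
    qed
  qed
qed

section \<open>Alternating vectors of short circuits\<close>

lemma alt_vec_Nil [simp]: "alt_vec [] e = 0"
  by (simp add: alt_vec_def)

lemma alt_vec_Cons: "alt_vec (x # xs) e = indicator {x} e - alt_vec xs e"
  by (simp add: alt_vec_def sum.lessThan_Suc_shift sum_negf del: sum.lessThan_Suc)

lemma alt_vec_append: "alt_vec (xs @ ys) e = alt_vec xs e + (- 1) ^ length xs * alt_vec ys e"
  by (induction xs) (auto simp: alt_vec_Cons)

lemma alt_vec_rev: "alt_vec (rev xs) e = (- 1) ^ Suc (length xs) * alt_vec xs e"
  by (induction xs) (auto simp: alt_vec_Cons alt_vec_append algebra_simps)

lemma minus_one_power_cong: "even m = even n \<Longrightarrow> (- 1 :: 'r::ring_1) ^ m = (- 1) ^ n"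
  by (cases "even m") auto

text \<open>The parities of the block lengths fix the sign with which each later block enters the
  alternating vector.\<close>

lemma alt_vec_concat_cong:
  assumes "list_all2 (\<lambda>b c. (even (length b) \<longleftrightarrow> even (length c)) \<and> alt_vec b = alt_vec c) bs cs"
  shows "alt_vec (concat bs) = alt_vec (concat cs)"
  using assms
proof (induction rule: list_all2_induct)
  case (Cons b bs c cs)
  then have "(- 1 :: int) ^ length b = (- 1) ^ length c" by (intro minus_one_power_cong) auto
  with Cons show ?case by (auto simp: alt_vec_append fun_eq_iff)
qed simp

section \<open>Walks and blocks of steps\<close>

text \<open>Unlike in \<open>cyclic_walk\<close>, the final node is listed explicitly, so that walks
  can be concatenated and reversed.\<close>

fun open_walk :: "('n, 'e) multigraph \<Rightarrow> 'n list \<Rightarrow> 'e list \<Rightarrow> bool" where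
  "open_walk H [u] [] \<longleftrightarrow> True"
| "open_walk H (u # v # ns) (f # fs) \<longleftrightarrow> ends H f = {u, v} \<and> open_walk H (v # ns) fs"
| "open_walk H _ _ \<longleftrightarrow> False"

lemma open_walk_nth:
  "open_walk H ns es \<Longrightarrow>
    length ns = Suc (length es) \<and> (\<forall>i<length es. ends H (es ! i) = {ns ! i, ns ! Suc i})"
  by (induction H ns es rule: open_walk.induct) (auto simp: nth_Cons split: nat.splits)

lemma open_walk_append:
  "open_walk H ns es \<Longrightarrow> open_walk H ms fs \<Longrightarrow> last ns = hd ms \<Longrightarrow>
    open_walk H (ns @ tl ms) (es @ fs)"
proof (induction H ns es rule: open_walk.induct)
  case (1 H u)
  then show ?case by (cases ms) auto
qed auto

lemma open_walk_rev: "open_walk H ns es \<Longrightarrow> open_walk H (rev ns) (rev es)"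
proof (induction H ns es rule: open_walk.induct)
  case (2 H u v ns f fs)
  then have "open_walk H (rev (v # ns) @ tl [v, u]) (rev fs @ [f])"
    by (intro open_walk_append) (auto simp: insert_commute)
  then show ?case by simp
qed auto

lemma cyclic_walk_close:
  assumes "open_walk H ns es" "es \<noteq> []" "hd ns = last ns" "set ns \<subseteq> nodes H" "set es \<subseteq> edges H"
  shows "cyclic_walk H (butlast ns) es"
  unfolding cyclic_walk_def
proof (intro conjI allI impI)
  note w = open_walk_nth[OF assms(1)]
  show "length (butlast ns) = length es" using w by simp
  show "set (butlast ns) \<subseteq> nodes H" using assms(4) by (auto dest: in_set_butlastD)
  show "set es \<subseteq> edges H" by fact
  fix i assume i: "i < length es"
  have "butlast ns ! (Suc i mod length es) = ns ! Suc i"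
  proof (cases "Suc i = length es")
    case True
    then have "ns ! Suc i = last ns" using w by (metis diff_Suc_1 last_conv_nth length_0_conv nat.distinct(1))
    then show ?thesis using True w assms(2,3) by (simp add: nth_butlast hd_conv_nth[symmetric])
      (metis hd_conv_nth length_0_conv nat.distinct(1))
  next
    case False
    then show ?thesis using i w by (simp add: nth_butlast)
  qed
  then show "ends H (es ! i) = {butlast ns ! i, butlast ns ! (Suc i mod length es)}"
    using w i by (simp add: nth_butlast)
qed

text \<open>A step is a node paired with the edge by which the walk leaves it. The last edge of a
  block thus leads out of the block, and the walk inside the block uses only the edges of its
  \<open>butlast\<close>.\<close>

abbreviation step_rel :: "('n, 'e) multigraph \<Rightarrow> 'n \<times> 'e \<Rightarrow> 'n \<times> 'e \<Rightarrow> bool" where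
  "step_rel H s s' \<equiv> ends H (snd s) = {fst s, fst s'}"

abbreviation steps_weight :: "('n, 'e) multigraph \<Rightarrow> ('n \<times> 'e) list \<Rightarrow> nat" where
  "steps_weight H b \<equiv> sum_list (map (\<lambda>s. node_wt H (fst s)) b)"

lemma open_walk_steps:
  "successively (step_rel H) b \<Longrightarrow> b \<noteq> [] \<Longrightarrow> open_walk H (map fst b) (map snd (butlast b))"
proof (induction b rule: induct_list012)
  case (3 s s' b)
  then have "open_walk H (map fst (s' # b)) (map snd (butlast (s' # b)))" by simp
  then show ?case using 3 by simp
qed auto

lemma sum_list_butlast_le: "sum_list (butlast xs) \<le> sum_list (xs :: nat list)"
  by (induction xs) auto

text \<open>One block followed by the reverse of the other is a closed even walk of weight at most
  \<open>lam\<close>, hence not an alternating circuit.\<close>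

lemma alt_vec_block_eq:
  fixes lam :: real
  assumes noc: "\<And>vs es. alternating_circuit H vs es \<Longrightarrow> \<not> real (walk_weight H vs) \<le> lam"
    and b: "successively (step_rel H) b" "b \<noteq> []" "set b \<subseteq> nodes H \<times> edges H"
      "real (steps_weight H b) \<le> lam / 2 \<or> length b = 1"
    and c: "successively (step_rel H) c" "c \<noteq> []" "set c \<subseteq> nodes H \<times> edges H"
      "real (steps_weight H c) \<le> lam / 2 \<or> length c = 1"
    and eq: "fst (hd b) = fst (hd c)" "last b = last c" "even (length b) = even (length c)"
  shows "alt_vec (map snd b) = alt_vec (map snd c)"
proof (cases "real (steps_weight H b) \<le> lam / 2 \<and> real (steps_weight H c) \<le> lam / 2")
  case False
  have hd_le: "node_wt H (fst (hd d)) \<le> steps_weight H d" if "d \<noteq> []" for d :: "(_ \<times> _) list"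
    using that by (cases d) auto
  \<comment> \<open>A block heavier than half of \<open>lam\<close> is a single step. If the other
    block were light, it would nevertheless start at the same heavy node, a contradiction.\<close>
  have "length b = 1 \<and> length c = 1"
  proof (cases "real (steps_weight H b) \<le> lam / 2")
    case True
    then have "length c = 1" using False c(4) by auto
    then have "steps_weight H c = node_wt H (fst (hd c))" by (auto simp: length_Suc_conv)
    then have "steps_weight H c = node_wt H (fst (hd b))" using eq(1) by simp
    then show ?thesis using False b(2) hd_le[of b] True by linarith
  next
    case f: False
    then have "length b = 1" using b(4) by auto
    then have "steps_weight H b = node_wt H (fst (hd b))" by (auto simp: length_Suc_conv)
    then have "steps_weight H b = node_wt H (fst (hd c))" using eq(1) by simp
    then show ?thesis using f c(2,4) hd_le[of c] \<open>length b = 1\<close> by linarith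
  qed
  then have "b = c" using eq by (auto simp: length_Suc_conv)
  then show ?thesis by simp
next
  case True
  \<comment> \<open>The blocks share their last step, so the return along \<open>c\<close> starts at
    the common last node, which \<open>tl\<close> avoids listing twice. The common first node closes
    the walk.\<close>
  let ?fb = "map snd (butlast b)" and ?fc = "map snd (butlast c)"
  let ?ns = "map fst b @ tl (rev (map fst c))" and ?es = "?fb @ rev ?fc"
  have split: "map snd b = ?fb @ [snd (last b)]" "map snd c = ?fc @ [snd (last b)]"
    using b(2) c(2) eq(2) by (metis append_butlast_last_id list.simps(8,9) map_append)+
  have "alt_vec ?es e = 0" for e
  proof (cases "?es = []")
    case False
    have "open_walk H ?ns ?es"
      using b c eq by (intro open_walk_append open_walk_rev open_walk_steps)
        (auto simp: last_map hd_rev)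
    moreover have "hd ?ns = last ?ns"
    proof -
      have "last (rev (map fst c)) = fst (hd c)" using c(2) by (simp add: last_rev hd_map)
      moreover have "last ?ns = last (rev (map fst c))"
      proof (cases "tl (rev (map fst c)) = []")
        case True
        then have "length (tl (rev (map fst c))) = 0" by (simp only: list.size)
        then have "length c = 1" using c(2) by (cases c) auto
        then obtain s where "c = [s]" by (auto simp: length_Suc_conv)
        then show ?thesis using b(2) eq(2) by (simp add: last_map)
      next
        case False
        then show ?thesis by (simp add: last_tl)
      qed
      ultimately have "last ?ns = fst (hd c)" by simp
      then show ?thesis using b(2) eq by (simp add: hd_map)
    qed
    moreover have "set (tl xs) \<subseteq> set xs" for xs :: "'a list" by (cases xs) auto
    from this[of "rev (map fst c)"] have "set (tl (rev (map fst c))) \<subseteq> fst ` set c" by simp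
    then have "set ?ns \<subseteq> nodes H" "set ?es \<subseteq> edges H"
      using b(3) c(3) by (force dest: in_set_butlastD)+
    ultimately have "cyclic_walk H (butlast ?ns) ?es" using False by (intro cyclic_walk_close)
    moreover have "even (length ?es)" using eq(3) b(2) c(2) by (cases b; cases c) auto
    moreover have "walk_weight H (butlast ?ns) \<le> steps_weight H b + steps_weight H c"
    proof -
      have "sum_list (map (node_wt H) (butlast ?ns)) \<le> sum_list (map (node_wt H) ?ns)"
        using sum_list_butlast_le[of "map (node_wt H) ?ns"] by (simp add: map_butlast)
      also have "\<dots> \<le> steps_weight H b + steps_weight H c"
        by (cases c rule: rev_cases) (auto simp: o_def rev_map[symmetric])
      finally show ?thesis by (simp add: walk_weight_def)
    qed
    then have "real (walk_weight H (butlast ?ns)) \<le> lam" using True by linarith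
    ultimately have "alt_vec ?es = (\<lambda>e. 0)"
      using noc unfolding alternating_circuit_def by blast
    then show ?thesis by simp
  qed simp
  moreover have "even (length ?fb) = even (length ?fc)" using eq(3) b(2) c(2) by (cases b; cases c) auto
  \<comment> \<open>Reversal contributes the sign that makes the vector of the closed walk the
    difference of the two, because the lengths have equal parity.\<close>
  ultimately have "alt_vec ?fb = alt_vec ?fc"
    by (auto simp: alt_vec_append alt_vec_rev fun_eq_iff minus_one_power_cong[of "length b - 1" "length c - 1"]
         simp flip: mult.assoc power_add)
  then show ?thesis
    unfolding split using \<open>even (length ?fb) = even (length ?fc)\<close>
    by (auto simp: alt_vec_append fun_eq_iff minus_one_power_cong)
qed

section \<open>Cutting a circuit into blocks and counting signatures\<close>

text \<open>Built from the right: a new step joins the first block if the weight permits and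
  otherwise opens a block of its own. In the latter case the two neighbouring blocks together exceed
  \<open>c\<close>.\<close>

lemma greedy_blocks:
  fixes c :: real and W :: "'s list \<Rightarrow> nat"
  assumes W: "\<And>s b. W (s # b) = W [s] + W b"
  shows "\<exists>bs. concat bs = ws \<and> [] \<notin> set bs \<and> (\<forall>b\<in>set bs. real (W b) \<le> c \<or> length b = 1) \<and>
    successively (\<lambda>b b'. c < real (W b + W b')) bs"
proof (induction ws)
  case Nil
  show ?case by (intro exI[of _ "[]"]) auto
next
  case (Cons s ws)
  then obtain bs where bs: "concat bs = ws" "[] \<notin> set bs" "\<forall>b\<in>set bs. real (W b) \<le> c \<or> length b = 1"
    "successively (\<lambda>b b'. c < real (W b + W b')) bs" by auto
  show ?case
  proof (cases bs)
    case Nil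
    then show ?thesis using bs by (intro exI[of _ "[[s]]"]) auto
  next
    case (Cons b bs')
    show ?thesis
    proof (cases "real (W [s] + W b) \<le> c")
      case True
      have "successively (\<lambda>b b'. c < real (W b + W b')) ((s # b) # bs')"
        using bs(4) Cons W[of s b] by (cases bs') auto
      then show ?thesis
        using True bs Cons W[of s b] by (intro exI[of _ "(s # b) # bs'"]) auto
    next
      case False
      then show ?thesis using bs Cons by (intro exI[of _ "[s] # bs"]) auto
    qed
  qed
qed

text \<open>Eight blocks would form four disjoint neighbouring pairs, each heavier than
  \<open>c\<close>.\<close>

lemma length_blocks_le_7:
  fixes c :: real and W :: "'s list \<Rightarrow> nat"
  assumes W: "\<And>a b. W (a @ b) = W a + W b"
    and bs: "successively (\<lambda>b b'. c < real (W b + W b')) bs" and le: "real (W (concat bs)) \<le> 4 * c"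
  shows "length bs \<le> 7"
proof (rule ccontr)
  assume "\<not> ?thesis"
  then have "8 \<le> length bs" by simp
  then obtain b1 b2 b3 b4 b5 b6 b7 b8 r where "bs = b1 # b2 # b3 # b4 # b5 # b6 # b7 # b8 # r"
    by (auto simp: Suc_le_length_iff numeral_eq_Suc)
  then show False using bs le W by auto
qed

definition arcs :: "('n, 'e) multigraph \<Rightarrow> ('n \<times> 'e \<times> 'n) set" where
  "arcs H = {(u, f, v). f \<in> edges H \<and> ends H f = {u, v}}"

text \<open>Records what \<open>alt_vec_block_eq\<close> compares: the last step and the parity of a
  block stand in its own entry, and its first node stands in the entry of its cyclic predecessor.
  The first three items form an arc, so few values are possible.\<close>

definition signature :: "('n \<times> 'e) list list \<Rightarrow> (('n \<times> 'e \<times> 'n) \<times> bool) list" where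
  "signature bs = map2 (\<lambda>b b'. ((fst (last b), snd (last b), fst (hd b')), even (length b)))
     bs (rotate1 bs)"

lemma successively_concat:
  assumes "successively R (concat bs @ [c])" "[] \<notin> set bs"
  shows "(\<forall>b\<in>set bs. successively R b) \<and> successively (\<lambda>b b'. R (last b) (hd b')) (bs @ [[c]])"
  using assms
proof (induction bs)
  case (Cons b bs)
  then have b: "b \<noteq> []" "[] \<notin> set bs" by auto
  have "successively R b" "successively R (concat bs @ [c])" "R (last b) (hd (concat bs @ [c]))"
    using Cons.prems(1) b by (auto simp: successively_append_iff)
  moreover from this(2) have "(\<forall>b\<in>set bs. successively R b) \<and>
      successively (\<lambda>b b'. R (last b) (hd b')) (bs @ [[c]])"
    using Cons.IH b(2) by blast
  moreover have "hd (concat bs @ [c]) = hd (hd (bs @ [[c]]))" using b(2) by (cases bs) auto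
  ultimately show ?case by (auto simp: successively_Cons)
qed auto

lemma block_decomposition:
  fixes lam :: real
  assumes C: "cyclic_walk H vs es" and w: "real (walk_weight H vs) \<le> 2 * lam" and "es \<noteq> []"
  obtains bs where "es = concat (map (map snd) bs)" "[] \<notin> set bs" "length bs \<le> 7"
    "\<And>b. b \<in> set bs \<Longrightarrow> real (steps_weight H b) \<le> lam / 2 \<or> length b = 1"
    "\<And>b. b \<in> set bs \<Longrightarrow> successively (step_rel H) b \<and> set b \<subseteq> nodes H \<times> edges H"
    "set (signature bs) \<subseteq> arcs H \<times> UNIV"
proof -
  let ?ws = "zip vs es"
  have len: "length vs = length es" and sub: "set vs \<subseteq> nodes H" "set es \<subseteq> edges H"
    and ends: "\<And>i. i < length es \<Longrightarrow> ends H (es ! i) = {vs ! i, vs ! (Suc i mod length es)}"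
    using C by (auto simp: cyclic_walk_def)
  obtain bs where bs: "concat bs = ?ws" "[] \<notin> set bs"
    "\<forall>b\<in>set bs. real (steps_weight H b) \<le> lam / 2 \<or> length b = 1"
    "successively (\<lambda>b b'. lam / 2 < real (steps_weight H b + steps_weight H b')) bs"
    using greedy_blocks[of "steps_weight H" ?ws "lam / 2"] by auto
  have wt: "steps_weight H ?ws = walk_weight H vs"
  proof -
    have "map (\<lambda>s. node_wt H (fst s)) ?ws = map (node_wt H) (map fst ?ws)" by simp
    then show ?thesis unfolding walk_weight_def using len by simp
  qed
  have len7: "length bs \<le> 7"
    using bs(1,4) w wt by (intro length_blocks_le_7[of "steps_weight H" "lam / 2"]) auto
  \<comment> \<open>Repeating the first step at the end turns the cyclic condition into a linear
    one; the link from the last block to the first is then an ordinary neighbour relation.\<close>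
  have cyc: "successively (step_rel H) (?ws @ [hd ?ws])"
    unfolding successively_conv_nth
  proof (intro allI impI)
    fix i assume "Suc i < length (?ws @ [hd ?ws])"
    then have i: "i < length es" using len by simp
    have "(?ws @ [hd ?ws]) ! Suc i = ?ws ! (Suc i mod length es)"
    proof (cases "Suc i = length es")
      case True
      moreover have "?ws \<noteq> []" using len \<open>es \<noteq> []\<close> by (cases vs; cases es) auto
      ultimately show ?thesis using len by (simp add: nth_append hd_conv_nth)
    next
      case False
      then show ?thesis using i len by (simp add: nth_append)
    qed
    then show "step_rel H ((?ws @ [hd ?ws]) ! i) ((?ws @ [hd ?ws]) ! Suc i)"
      using i len ends[OF i] \<open>es \<noteq> []\<close> by (simp add: nth_append)
  qed
  have "bs \<noteq> []" using bs(1) \<open>es \<noteq> []\<close> len by auto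
  then have hdws: "hd ?ws = hd (hd bs)" using bs(1,2) by (cases bs) (metis concat.simps(2) hd_append2 list.sel(1) list.set_intros(1))+
  note sc = successively_concat[of "step_rel H" bs "hd ?ws", unfolded bs(1), OF cyc bs(2)]
  have setb: "set b \<subseteq> nodes H \<times> edges H" if "b \<in> set bs" for b
  proof -
    have "set b \<subseteq> set ?ws" using that bs(1) by (metis UN_upper set_concat)
    moreover have "set ?ws \<subseteq> nodes H \<times> edges H"
      using sub by (auto dest: set_zip_leftD set_zip_rightD)
    ultimately show ?thesis by blast
  qed
  have link: "step_rel H (last (bs ! j)) (hd (rotate1 bs ! j))" if "j < length bs" for j
  proof -
    have "step_rel H (last ((bs @ [[hd ?ws]]) ! j)) (hd ((bs @ [[hd ?ws]]) ! Suc j))"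
      using sc that by (auto simp: successively_conv_nth)
    moreover have "hd ((bs @ [[hd ?ws]]) ! Suc j) = hd (rotate1 bs ! j)"
      using that hdws \<open>bs \<noteq> []\<close> by (cases bs) (auto simp: nth_append)
    ultimately show ?thesis using that by (simp add: nth_append)
  qed
  show ?thesis
  proof (rule that[of bs])
    have "map snd (concat bs) = es" using bs(1) len by simp
    then show "es = concat (map (map snd) bs)" by (simp add: map_concat)
    show "set (signature bs) \<subseteq> arcs H \<times> UNIV"
    proof
      fix a assume "a \<in> set (signature bs)"
      then obtain j where j: "j < length bs"
        "a = ((fst (last (bs ! j)), snd (last (bs ! j)), fst (hd (rotate1 bs ! j))), even (length (bs ! j)))"
        by (auto simp: signature_def set_zip)
      moreover have "snd (last (bs ! j)) \<in> edges H"
        using setb[of "bs ! j"] j(1) bs(2) last_in_set[of "bs ! j"]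
        by (metis mem_Times_iff nth_mem subsetD)
      ultimately show "a \<in> arcs H \<times> UNIV" using link[of j] by (auto simp: arcs_def)
    qed
  qed (use bs len7 sc setb in auto)
qed

lemma alt_vec_determined_by_signature:
  fixes lam :: real
  assumes noc: "\<And>vs es. alternating_circuit H vs es \<Longrightarrow> \<not> real (walk_weight H vs) \<le> lam"
    and bs: "[] \<notin> set bs"
    "\<And>b. b \<in> set bs \<Longrightarrow> real (steps_weight H b) \<le> lam / 2 \<or> length b = 1"
    "\<And>b. b \<in> set bs \<Longrightarrow> successively (step_rel H) b \<and> set b \<subseteq> nodes H \<times> edges H"
    and cs: "[] \<notin> set cs"
    "\<And>b. b \<in> set cs \<Longrightarrow> real (steps_weight H b) \<le> lam / 2 \<or> length b = 1"
    "\<And>b. b \<in> set cs \<Longrightarrow> successively (step_rel H) b \<and> set b \<subseteq> nodes H \<times> edges H"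
    and sig: "signature bs = signature cs"
  shows "alt_vec (concat (map (map snd) bs)) = alt_vec (concat (map (map snd) cs))"
proof (rule alt_vec_concat_cong)
  have len: "length bs = length cs"
    using arg_cong[OF sig, of length] by (simp add: signature_def)
  have sig_nth: "signature ds ! j =
      ((fst (last (ds ! j)), snd (last (ds ! j)), fst (hd (rotate1 ds ! j))), even (length (ds ! j)))"
    if "j < length ds" for ds :: "('a \<times> 'b) list list" and j
    using that by (simp add: signature_def)
  have eqs: "last (bs ! j) = last (cs ! j)" "fst (hd (rotate1 bs ! j)) = fst (hd (rotate1 cs ! j))"
    "even (length (bs ! j)) = even (length (cs ! j))" if "j < length bs" for j
    using sig_nth[of j bs] sig_nth[of j cs] that len sig by (auto simp: prod_eq_iff)
  have hd_eq: "fst (hd (bs ! j)) = fst (hd (cs ! j))" if "j < length bs" for j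
  proof -
    \<comment> \<open>The cyclic predecessor of \<open>j\<close>; the length is added before
      subtracting 1 so that index 0 does not truncate.\<close>
    have rot: "rotate1 ds ! ((j + length ds - 1) mod length ds) = ds ! j"
      if "j < length ds" for ds :: "('a \<times> 'b) list list"
    proof -
      have "(j + length ds - 1) mod length ds < length ds" using that by (intro mod_less_divisor) auto
      then have "rotate1 ds ! ((j + length ds - 1) mod length ds) =
          ds ! (Suc ((j + length ds - 1) mod length ds) mod length ds)" by (rule nth_rotate1)
      also have "Suc ((j + length ds - 1) mod length ds) mod length ds = j"
        using that by (simp add: mod_Suc_eq Suc_diff_le[symmetric])
      finally show ?thesis .
    qed
    have "(j + length bs - 1) mod length bs < length bs" using that by (intro mod_less_divisor) auto
    then show ?thesis
      using rot[of bs] rot[of cs] eqs(2)[of "(j + length bs - 1) mod length bs"] that len by simp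
  qed
  show "list_all2 (\<lambda>b c. (even (length b) \<longleftrightarrow> even (length c)) \<and> alt_vec b = alt_vec c)
      (map (map snd) bs) (map (map snd) cs)"
  proof (rule list_all2_all_nthI)
    fix j assume "j < length (map (map snd) bs)"
    then have j: "j < length bs" "j < length cs" using len by auto
    then have m: "bs ! j \<in> set bs" "cs ! j \<in> set cs" by auto
    have "alt_vec (map snd (bs ! j)) = alt_vec (map snd (cs ! j))"
      using m bs cs eqs[OF j(1)] hd_eq[OF j(1)]
      by (intro alt_vec_block_eq[of H lam]) (auto simp: noc)
    then show "even (length (map (map snd) bs ! j)) = even (length (map (map snd) cs ! j)) \<and>
        alt_vec (map (map snd) bs ! j) = alt_vec (map (map snd) cs ! j)"
      using eqs[OF j(1)] j by simp
  qed (use len in simp)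
qed

text \<open>A choice of decomposition for each vector makes the signature injective. Signatures are
  lists of length at most 7 over at most 2N symbols; the eight possible lengths contribute at most
  (2N)^7 each.\<close>

lemma card_alt_vec_le:
  fixes lam :: real
  assumes noc: "\<And>vs es. alternating_circuit H vs es \<Longrightarrow> \<not> real (walk_weight H vs) \<le> lam"
    and arcs: "finite (arcs H)" "card (arcs H) \<le> N" "1 \<le> N"
  defines "A \<equiv> {alt_vec es | vs es. alternating_circuit H vs es \<and> real (walk_weight H vs) \<le> 2 * lam}"
  shows "finite A" "card A \<le> 8 * (2 * N) ^ 7"
proof -
  define \<Sigma> where "\<Sigma> = {\<sigma>. set \<sigma> \<subseteq> arcs H \<times> (UNIV :: bool set) \<and> length \<sigma> \<le> 7}"
  define P where "P = (\<lambda>bs. [] \<notin> set bs \<and> (\<forall>b\<in>set bs. (real (steps_weight H b) \<le> lam / 2 \<or> length b = 1)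
    \<and> successively (step_rel H) b \<and> set b \<subseteq> nodes H \<times> edges H))"
  have "\<exists>bs. P bs \<and> signature bs \<in> \<Sigma> \<and> a = alt_vec (concat (map (map snd) bs))" if "a \<in> A" for a
  proof -
    obtain vs es where C: "alternating_circuit H vs es" "real (walk_weight H vs) \<le> 2 * lam" "a = alt_vec es"
      using \<open>a \<in> A\<close> by (auto simp: A_def)
    then have "cyclic_walk H vs es" "es \<noteq> []" by (auto simp: alternating_circuit_def fun_eq_iff)
    then obtain bs where "es = concat (map (map snd) bs)" "[] \<notin> set bs" "length bs \<le> 7"
      "\<And>b. b \<in> set bs \<Longrightarrow> real (steps_weight H b) \<le> lam / 2 \<or> length b = 1"
      "\<And>b. b \<in> set bs \<Longrightarrow> successively (step_rel H) b \<and> set b \<subseteq> nodes H \<times> edges H"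
      "set (signature bs) \<subseteq> arcs H \<times> UNIV"
      using block_decomposition[OF _ C(2)] by blast
    then show ?thesis using C by (intro exI[of _ bs]) (auto simp: P_def \<Sigma>_def signature_def)
  qed
  then obtain g where g: "\<And>a. a \<in> A \<Longrightarrow> P (g a) \<and> signature (g a) \<in> \<Sigma> \<and> a = alt_vec (concat (map (map snd) (g a)))"
    by metis
  have inj: "inj_on (\<lambda>a. signature (g a)) A"
  proof (rule inj_onI)
    fix a a' assume a: "a \<in> A" "a' \<in> A" "signature (g a) = signature (g a')"
    then have "alt_vec (concat (map (map snd) (g a))) = alt_vec (concat (map (map snd) (g a')))"
      using g[of a] g[of a'] unfolding P_def by (intro alt_vec_determined_by_signature[OF noc]) auto
    then show "a = a'" using g[OF a(1)] g[OF a(2)] by metis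
  qed
  have sub: "(\<lambda>a. signature (g a)) ` A \<subseteq> \<Sigma>" using g by auto
  have fin: "finite \<Sigma>" unfolding \<Sigma>_def using arcs by (intro finite_lists_length_le) auto
  show "finite A" using inj_on_finite[OF inj sub fin] .
  have "card A \<le> card \<Sigma>" using card_inj_on_le[OF inj sub fin] .
  also have "\<dots> = (\<Sum>i\<le>7. (2 * card (arcs H)) ^ i)"
    unfolding \<Sigma>_def using arcs by (subst card_lists_length_le) (auto simp: card_cartesian_product mult.commute)
  also have "\<dots> \<le> (\<Sum>i\<le>(7::nat). (2 * N) ^ 7)"
  proof (rule sum_mono)
    fix i assume "i \<in> {..(7::nat)}"
    then have "(2 * card (arcs H)) ^ i \<le> (2 * N) ^ i" using arcs by (intro power_mono) auto
    moreover have "(2 * N) ^ i \<le> (2 * N) ^ 7"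
      using arcs \<open>i \<in> {..7}\<close> by (intro power_increasing) auto
    ultimately show "(2 * card (arcs H)) ^ i \<le> (2 * N) ^ 7" by (rule order_trans)
  qed
  finally show "card A \<le> 8 * (2 * N) ^ 7" by simp
qed

section \<open>Isolation by small moduli\<close>

text \<open>The induction rests on
  \<open>1 / (k * (n+1 choose k)) = 1 / (k * (n choose k)) - 1 / ((k+1) * (n+1 choose k+1))\<close>.\<close>

lemma mult_binomial_dvd:
  fixes L k j :: nat
  assumes "1 \<le> k" "\<And>i. i \<in> {k..k + j} \<Longrightarrow> i dvd L"
  shows "k * ((k + j) choose k) dvd L"
  using assms
proof (induction j arbitrary: k)
  case 0
  then show ?case by simp
next
  case (Suc j)
  define n where "n = k + j"
  have "k * (n choose k) dvd L" unfolding n_def using Suc.prems by (intro Suc.IH) auto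
  then obtain a where a: "L = k * (n choose k) * a" by auto
  have "Suc k * ((Suc k + j) choose Suc k) dvd L" using Suc.prems by (intro Suc.IH) auto
  then obtain b where b: "L = Suc k * (Suc n choose Suc k) * b" by (auto simp: n_def)
  define X Y Z :: int where "X = int (k * (n choose k))" and "Y = int (Suc k * (Suc n choose Suc k))"
    and "Z = int (k * (Suc n choose k))"
  have Y: "Y = int (Suc n) * int (n choose k)"
    unfolding Y_def of_nat_mult[symmetric] using Suc_times_binomial_eq[of n k] by (simp add: mult.commute)
  have "(Suc n - k) * (Suc n choose k) = Suc n * (n choose k)"
    using binomial_absorb_comp[of "Suc n" k] by simp
  then have "int (Suc n - k) * int (Suc n choose k) = int (Suc n) * int (n choose k)"
    by (metis of_nat_mult)
  then have Z: "(int (Suc n) - int k) * Z = int k * Y"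
    unfolding Z_def Y using Suc.prems by (simp add: n_def of_nat_diff algebra_simps)
  \<comment> \<open>This is 1/Z = 1/X - 1/Y with denominators cleared; hence L/Z = a - b is an
    integer.\<close>
  have "Z * (Y - X) = X * Y"
  proof -
    have "Y - X = (int (Suc n) - int k) * int (n choose k)" unfolding Y X_def by (simp add: algebra_simps)
    then have "Z * (Y - X) = (int (Suc n) - int k) * Z * int (n choose k)" by simp
    also have "\<dots> = X * Y" unfolding Z X_def by simp
    finally show ?thesis .
  qed
  moreover have La: "int L = X * int a" and Lb: "int L = Y * int b"
    using a b unfolding X_def Y_def by (metis of_nat_mult)+
  ultimately have "X * Y * (Z * (int a - int b)) = X * Y * int L"
  proof -
    have "X * Y * (Z * (int a - int b)) = Z * (Y * (X * int a) - X * (Y * int b))"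
      by (simp add: algebra_simps)
    also have "\<dots> = Z * (Y - X) * int L" unfolding La[symmetric] Lb[symmetric] by (simp add: algebra_simps)
    finally show ?thesis using \<open>Z * (Y - X) = X * Y\<close> by simp
  qed
  moreover have "X * Y \<noteq> 0" unfolding Y X_def using Suc.prems(1) by (simp add: n_def)
  ultimately have "Z dvd int L" by (metis dvd_triv_left mult_left_cancel)
  then show ?case unfolding Z_def n_def by (metis add_Suc_right of_nat_dvd_iff)
qed

text \<open>With k = m div 2, the number k * (2k choose k) divides \<open>L\<close>. Its factor k
  compensates the denominator 2k in the lower bound 4^k / (2k) for the central binomial coefficient,
  so 4^k \<le> 2L.\<close>

lemma common_multiple_lower_bound:
  fixes L m :: nat
  assumes "0 < L" "\<And>k. k \<in> {2..m} \<Longrightarrow> k dvd L"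
  shows "2 ^ m \<le> 4 * L"
proof (cases "m < 2")
  case True
  then have "m = 0 \<or> m = 1" by linarith
  then show ?thesis using assms(1) by auto
next
  case False
  define k where "k = m div 2"
  have k: "1 \<le> k" "k + k \<le> m" "m \<le> Suc (k + k)" using False by (auto simp: k_def)
  have "i dvd L" if "i \<in> {k..k + k}" for i
    using assms(2)[of i] that k by (cases "i = 1") auto
  then have "k * ((k + k) choose k) dvd L" using k(1) by (rule mult_binomial_dvd[rotated])
  then have "k * ((k + k) choose k) \<le> L" using assms(1) by (rule dvd_imp_le)
  moreover have "4 ^ k / (2 * real k) \<le> real ((2 * k) choose k)"
    using k by (intro central_binomial_lower_bound) auto
  then have "4 ^ k \<le> real ((2 * k) choose k) * (2 * real k)"
    using k by (subst (asm) pos_divide_le_eq) auto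
  then have "real (4 ^ k) \<le> real (2 * (k * ((k + k) choose k)))"
    by (simp add: mult_2[of k, symmetric] mult_ac)
  then have "4 ^ k \<le> 2 * (k * ((k + k) choose k))" by (simp only: of_nat_le_iff)
  ultimately have "(4::nat) ^ k \<le> 2 * L" by linarith
  moreover have "(2::nat) ^ m \<le> 2 ^ Suc (k + k)" using k by (intro power_increasing) auto
  moreover have "(2::nat) ^ Suc (k + k) = 2 * 4 ^ k" by (simp add: power_add flip: power_mult_distrib)
  ultimately show ?thesis by linarith
qed

text \<open>Otherwise the product of the absolute values would be a positive common multiple of 2,
  ..., m with too few bits.\<close>

lemma exists_common_nondivisor:
  fixes A :: "int set"
  assumes "finite A" "\<And>a. a \<in> A \<Longrightarrow> a \<noteq> 0" "\<And>a. a \<in> A \<Longrightarrow> \<bar>a\<bar> \<le> 2 ^ c" "card A * c + 2 < m"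
  shows "\<exists>k\<in>{2..m}. \<forall>a\<in>A. \<not> int k dvd a"
proof (rule ccontr)
  assume "\<not> ?thesis"
  then have dvd: "\<exists>a\<in>A. int k dvd a" if "k \<in> {2..m}" for k using that by blast
  define P where "P = (\<Prod>a\<in>A. nat \<bar>a\<bar>)"
  have "0 < P" unfolding P_def using assms(2) by (intro prod_pos) auto
  moreover have "k dvd P" if k: "k \<in> {2..m}" for k
  proof -
    obtain a where a: "a \<in> A" "int k dvd a" using dvd[OF k] by auto
    then have "k dvd nat \<bar>a\<bar>" by simp
    also have "nat \<bar>a\<bar> dvd P" unfolding P_def using assms(1) a(1) by (rule dvd_prodI)
    finally show ?thesis .
  qed
  ultimately have "2 ^ m \<le> 4 * P" by (rule common_multiple_lower_bound)
  also have "P \<le> (\<Prod>a\<in>A. 2 ^ c)"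
    unfolding P_def
  proof (rule prod_mono)
    fix a assume "a \<in> A"
    then show "0 \<le> nat \<bar>a\<bar> \<and> nat \<bar>a\<bar> \<le> 2 ^ c" using assms(3)[of a] by (simp add: nat_le_iff)
  qed
  also have "(\<Prod>a\<in>A. 2 ^ c) = (2::nat) ^ (card A * c)" by (simp add: power_mult mult.commute)
  finally have "(2::nat) ^ m \<le> 2 ^ (card A * c + 2)" by (simp add: power_add)
  then have "m \<le> card A * c + 2" by (rule power_le_imp_le_exp[rotated]) simp
  then show False using assms(4) by simp
qed

section \<open>Numbers with signed digits\<close>

text \<open>Modulo the next power of \<open>B\<close> only the lowest nonzero digit survives, and it
  is too small to be divisible by \<open>B\<close>.\<close>

lemma base_expansion_nonzero:
  fixes z :: "'e \<Rightarrow> int" and B :: int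
  assumes E: "finite E" "inj_on idx E" and B: "\<And>e. e \<in> E \<Longrightarrow> \<bar>z e\<bar> < B"
    and z: "\<exists>e\<in>E. z e \<noteq> 0"
  shows "(\<Sum>e\<in>E. z e * B ^ idx e) \<noteq> 0"
proof
  assume 0: "(\<Sum>e\<in>E. z e * B ^ idx e) = 0"
  obtain e where e: "e \<in> E" "z e \<noteq> 0" "\<And>f. f \<in> E \<Longrightarrow> z f \<noteq> 0 \<Longrightarrow> idx e \<le> idx f"
    using z ex_has_least_nat[of "\<lambda>e. e \<in> E \<and> z e \<noteq> 0" _ idx] by blast
  have "B > 0" using B[OF e(1)] by linarith
  have "B ^ Suc (idx e) dvd (\<Sum>f\<in>E - {e}. z f * B ^ idx f)"
  proof (rule dvd_sum)
    fix f assume f: "f \<in> E - {e}"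
    show "B ^ Suc (idx e) dvd z f * B ^ idx f"
    proof (cases "z f = 0")
      case False
      then have "idx e \<le> idx f" "idx e \<noteq> idx f" using e f E(2) by (auto dest: inj_onD)
      then have "B ^ Suc (idx e) dvd B ^ idx f" by (intro le_imp_power_dvd) auto
      then show ?thesis by simp
    qed simp
  qed
  moreover have "z e * B ^ idx e = - (\<Sum>f\<in>E - {e}. z f * B ^ idx f)"
    using 0 sum.remove[OF E(1) e(1), of "\<lambda>f. z f * B ^ idx f"] by simp
  ultimately have "B * B ^ idx e dvd z e * B ^ idx e" by simp
  then have "B dvd z e" using \<open>B > 0\<close> by simp
  then show False using e(2) B[OF e(1)] dvd_imp_le_int[of "z e" B] by linarith
qed

lemma base_expansion_bound:
  fixes z :: "'e \<Rightarrow> int" and B :: int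
  assumes E: "bij_betw idx E {1..m}" and B: "\<And>e. e \<in> E \<Longrightarrow> \<bar>z e\<bar> < B" "0 < B"
  shows "\<bar>\<Sum>e\<in>E. z e * B ^ idx e\<bar> \<le> B ^ Suc m"
proof -
  have "\<bar>\<Sum>e\<in>E. z e * B ^ idx e\<bar> \<le> (\<Sum>e\<in>E. \<bar>z e * B ^ idx e\<bar>)" by (rule sum_abs)
  also have "\<dots> \<le> (\<Sum>e\<in>E. (B - 1) * B ^ idx e)"
    using B by (intro sum_mono) (force simp: abs_mult intro!: mult_right_mono)
  also have "\<dots> = (\<Sum>j=1..m. (B - 1) * B ^ j)"
    using sum.reindex_bij_betw[OF E, of "\<lambda>j. (B - 1) * B ^ j"] by simp
  also have "\<dots> \<le> B ^ Suc m"
  proof -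
    have "(\<Sum>j=1..m. (B - 1) * B ^ j) = B ^ Suc m - B"
      by (induction m) (auto simp: algebra_simps)
    then show ?thesis using B(2) by simp
  qed
  finally show ?thesis .
qed

section \<open>Faces of the perfect matching polytope\<close>

text \<open>An arbitrary orientation, which presents the simple graph by end maps as required for
  \<open>frac_pm\<close>.\<close>

definition edge_fst :: "'a set \<Rightarrow> 'a" where
  "edge_fst e = (SOME v. v \<in> e)"

definition edge_snd :: "'a set \<Rightarrow> 'a" where
  "edge_snd e = (SOME v. v \<in> e - {edge_fst e})"

lemma edge_fst_snd:
  assumes "card e = 2"
  shows "e = {edge_fst e, edge_snd e}" "edge_fst e \<noteq> edge_snd e"
proof -
  obtain a b where ab: "e = {a, b}" "a \<noteq> b" using assms by (auto simp: card_2_iff)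
  have 1: "edge_fst e \<in> e" unfolding edge_fst_def by (rule someI[of _ a]) (simp add: ab)
  then have "\<exists>v. v \<in> e - {edge_fst e}" using ab by auto
  then have "edge_snd e \<in> e - {edge_fst e}" unfolding edge_snd_def by (rule someI_ex)
  then show "e = {edge_fst e, edge_snd e}" "edge_fst e \<noteq> edge_snd e" using 1 ab by auto
qed

lemma cut_edges_eq_bcut:
  assumes "\<And>e. e \<in> E \<Longrightarrow> card e = 2"
  shows "cut_edges E S = bcut edge_fst edge_snd E S"
proof -
  have "card (e \<inter> S) = 1 \<longleftrightarrow> (edge_fst e \<in> S) \<noteq> (edge_snd e \<in> S)" if "e \<in> E" for e
  proof -
    have "card ({a, b} \<inter> S) = 1 \<longleftrightarrow> (a \<in> S) \<noteq> (b \<in> S)" if "a \<noteq> b" for a b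
      using that by (simp add: Int_insert_left)
    from this[OF edge_fst_snd(2)[OF assms[OF that]]] show ?thesis
      unfolding edge_fst_snd(1)[OF assms[OF that], symmetric] .
  qed
  then show ?thesis unfolding cut_edges_def bcut_def by auto
qed

lemma simple_graph_finite:
  assumes "simple_graph V E"
  shows "finite V" "finite E" "\<And>e. e \<in> E \<Longrightarrow> card e = 2" "\<And>e. e \<in> E \<Longrightarrow> e \<subseteq> V"
  using assms finite_subset[of E "Pow V"] by (auto simp: simple_graph_def)

lemma exists_small_scale:
  fixes a b :: "'i \<Rightarrow> real"
  assumes "finite I" "\<And>i. i \<in> I \<Longrightarrow> 0 < a i"
  shows "\<exists>\<epsilon>>0. \<forall>i\<in>I. \<epsilon> * \<bar>b i\<bar> \<le> a i"
  using assms
proof (induction I rule: finite_induct)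
  case empty
  show ?case by (intro exI[of _ 1]) auto
next
  case (insert i I)
  then obtain \<epsilon> where \<epsilon>: "\<epsilon> > 0" "\<forall>i\<in>I. \<epsilon> * \<bar>b i\<bar> \<le> a i" by auto
  define \<delta> where "\<delta> = min \<epsilon> (a i / (\<bar>b i\<bar> + 1))"
  have "a i > 0" using insert.prems by simp
  then have "\<delta> > 0" using \<epsilon> by (simp add: \<delta>_def add_nonneg_pos)
  moreover have "\<delta> * \<bar>b i\<bar> \<le> a i"
  proof -
    have "\<delta> * \<bar>b i\<bar> \<le> \<delta> * (\<bar>b i\<bar> + 1)" using \<open>\<delta> > 0\<close> by simp
    also have "\<dots> \<le> a i / (\<bar>b i\<bar> + 1) * (\<bar>b i\<bar> + 1)"
      by (intro mult_right_mono) (auto simp: \<delta>_def)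
    also have "\<dots> = a i" by (simp add: add_nonneg_eq_0_iff)
    finally show ?thesis .
  qed
  moreover have "\<delta> * \<bar>b j\<bar> \<le> a j" if "j \<in> I" for j
  proof -
    have "\<delta> * \<bar>b j\<bar> \<le> \<epsilon> * \<bar>b j\<bar>" by (intro mult_right_mono) (auto simp: \<delta>_def)
    then show ?thesis using \<epsilon>(2) that by force
  qed
  ultimately show ?case by (intro exI[of _ \<delta>]) auto
qed

text \<open>Equalities valid at \<open>x\<close> are preserved by \<open>z\<close>. Only finitely
  many strict inequalities remain, and a small enough step respects their slack.\<close>

lemma face_perturb:
  fixes z :: "'a set \<Rightarrow> real"
  assumes G: "simple_graph V E" and F: "is_face V E F" and x: "x \<in> F"
    and supp: "\<And>e. z e \<noteq> 0 \<Longrightarrow> e \<in> E \<and> 0 < x e"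
    and tight: "\<And>S. S \<subseteq> V \<Longrightarrow> odd (card S) \<Longrightarrow> sum x (cut_edges E S) = 1 \<Longrightarrow> sum z (cut_edges E S) = 0"
  shows "\<exists>\<epsilon>>0. (\<lambda>e. x e + \<epsilon> * z e) \<in> F"
proof -
  note fin = simple_graph_finite[OF G]
  obtain \<S> D where SD: "\<S> \<subseteq> {S. S \<subseteq> V \<and> odd (card S)}" "D \<subseteq> E"
    "F = {x \<in> PM V E. (\<forall>S\<in>\<S>. sum x (cut_edges E S) = 1) \<and> (\<forall>e\<in>D. x e = 0)}"
    using F by (auto simp: is_face_def)
  have PM: "x \<in> PM V E" using x SD(3) by auto
  have "\<exists>\<epsilon>>0. \<forall>e\<in>{e\<in>E. 0 < x e}. \<epsilon> * \<bar>z e\<bar> \<le> x e"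
    by (rule exists_small_scale) (use fin(2) in auto)
  then obtain \<epsilon>1 where e1: "\<epsilon>1 > 0" "\<And>e. e \<in> E \<Longrightarrow> 0 < x e \<Longrightarrow> \<epsilon>1 * \<bar>z e\<bar> \<le> x e" by blast
  have "\<exists>\<epsilon>>0. \<forall>S\<in>{S. S \<subseteq> V \<and> 1 < sum x (cut_edges E S)}.
      \<epsilon> * \<bar>sum z (cut_edges E S)\<bar> \<le> sum x (cut_edges E S) - 1"
    by (rule exists_small_scale) (use fin(1) in auto)
  then obtain \<epsilon>2 where e2: "\<epsilon>2 > 0" "\<And>S. S \<subseteq> V \<Longrightarrow> 1 < sum x (cut_edges E S) \<Longrightarrow>
      \<epsilon>2 * \<bar>sum z (cut_edges E S)\<bar> \<le> sum x (cut_edges E S) - 1" by blast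
  define \<epsilon> where "\<epsilon> = min \<epsilon>1 \<epsilon>2"
  have pos: "\<epsilon> > 0" using e1 e2 by (simp add: \<epsilon>_def)
  let ?y = "\<lambda>e. x e + \<epsilon> * z e"
  have sum_y: "sum ?y A = sum x A + \<epsilon> * sum z A" for A
    by (simp add: sum.distrib sum_distrib_left)
  have nonneg: "0 \<le> ?y e" if "e \<in> E" for e
  proof (cases "z e = 0")
    case True
    then show ?thesis using PM that by (auto simp: PM_def)
  next
    case False
    then have "\<epsilon>1 * \<bar>z e\<bar> \<le> x e" using supp e1 by auto
    moreover have "\<epsilon> * \<bar>z e\<bar> \<le> \<epsilon>1 * \<bar>z e\<bar>" by (intro mult_right_mono) (auto simp: \<epsilon>_def)
    moreover have "- (\<epsilon> * \<bar>z e\<bar>) \<le> \<epsilon> * z e" using pos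
      by (metis abs_ge_minus_self abs_minus_cancel minus_le_iff mult_le_cancel_left_pos mult_minus_right)
    ultimately show ?thesis by linarith
  qed
  have cut: "1 \<le> sum ?y (cut_edges E S)" if S: "S \<subseteq> V" "odd (card S)" for S
  proof (cases "sum x (cut_edges E S) = 1")
    case True
    then show ?thesis using tight[OF S] by (simp add: sum_y)
  next
    case False
    moreover have "1 \<le> sum x (cut_edges E S)" using PM S unfolding PM_def by blast
    ultimately have "1 < sum x (cut_edges E S)" by simp
    then have "\<epsilon>2 * \<bar>sum z (cut_edges E S)\<bar> \<le> sum x (cut_edges E S) - 1" using e2 S by auto
    moreover have "\<epsilon> * \<bar>sum z (cut_edges E S)\<bar> \<le> \<epsilon>2 * \<bar>sum z (cut_edges E S)\<bar>"
      by (intro mult_right_mono) (auto simp: \<epsilon>_def)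
    moreover have "- (\<epsilon> * \<bar>sum z (cut_edges E S)\<bar>) \<le> \<epsilon> * sum z (cut_edges E S)" using pos
      by (metis abs_ge_minus_self abs_minus_cancel minus_le_iff mult_le_cancel_left_pos mult_minus_right)
    ultimately show ?thesis unfolding sum_y by linarith
  qed
  have "?y \<in> PM V E"
    unfolding PM_def
  proof (intro CollectI conjI allI impI ballI)
    fix v assume "v \<in> V"
    then have "sum x (cut_edges E {v}) = 1" using PM by (auto simp: PM_def)
    moreover from this have "sum z (cut_edges E {v}) = 0" using tight[of "{v}"] \<open>v \<in> V\<close> by auto
    ultimately show "sum ?y (cut_edges E {v}) = 1" by (simp add: sum_y)
  next
    fix e assume "e \<notin> E"
    then show "x e + \<epsilon> * z e = 0" using supp[of e] PM by (auto simp: PM_def)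
  qed (use nonneg cut in auto)
  moreover have "sum ?y (cut_edges E S) = 1" if "S \<in> \<S>" for S
    using that SD x tight[of S] by (auto simp: sum_y)
  moreover have "?y e = 0" if "e \<in> D" for e
    using that SD x supp[of e] by auto
  ultimately have "?y \<in> F" using SD(3) by auto
  then show ?thesis using pos by blast
qed

lemma edge_inner_combine:
  fixes w :: "'a set \<Rightarrow> real"
  shows "edge_inner E w (\<lambda>e. x e + \<epsilon> * z e) = edge_inner E w x + \<epsilon> * edge_inner E w z"
  by (simp add: edge_inner_def sum.distrib sum_distrib_left algebra_simps)

lemma frac_pm_support:
  assumes G: "simple_graph V E" and x: "x \<in> PM V E"
  defines "E' \<equiv> {e \<in> E. 0 < x e}"
  shows "frac_pm edge_fst edge_snd V E' x"
    and "\<And>S. sum x (bcut edge_fst edge_snd E' S) = sum x (cut_edges E S)"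
proof -
  note fin = simple_graph_finite[OF G]
  show eq: "sum x (bcut edge_fst edge_snd E' S) = sum x (cut_edges E S)" for S
    unfolding cut_edges_eq_bcut[OF fin(3), of E, simplified] 
  proof (rule sum.mono_neutral_left)
    show "\<forall>i\<in>bcut edge_fst edge_snd E S - bcut edge_fst edge_snd E' S. x i = 0"
      using x by (auto simp: bcut_def E'_def PM_def order.strict_iff_order)
  qed (use fin in \<open>auto simp: bcut_def E'_def\<close>)
  have "edge_fst e \<in> V \<and> edge_snd e \<in> V \<and> edge_fst e \<noteq> edge_snd e" if "e \<in> E" for e
    using edge_fst_snd[OF fin(3)[OF that]] fin(4)[OF that] by (metis insert_subset)
  then show "frac_pm edge_fst edge_snd V E' x"
    unfolding frac_pm_def eq using fin x by (auto simp: E'_def PM_def)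
qed

text \<open>Edmonds' theorem yields \<open>M\<close> in the smallest face containing
  \<open>x\<close>. Hence \<open>x\<close> can be moved a little away from \<open>M\<close> inside
  \<open>F\<close>; if \<open>M\<close> cost more than \<open>x\<close>, this would lower the cost
  below the minimum.\<close>

lemma perfect_matching_in_Min_face:
  assumes G: "simple_graph V E" and F: "is_face V E F" and x: "x \<in> Min_face E F w"
    and e: "e \<in> E" "0 < x e"
  shows "\<exists>M. perfect_matching V E M \<and> indicator M \<in> Min_face E F w \<and> e \<in> M"
proof -
  note fin = simple_graph_finite[OF G]
  have ends: "edge_fst f \<in> V" "edge_snd f \<in> V" "edge_fst f \<noteq> edge_snd f" if "f \<in> E" for f
    using edge_fst_snd[OF fin(3)[OF that]] fin(4)[OF that] by (metis insert_subset)+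
  note cb = cut_edges_eq_bcut[OF fin(3), of E, simplified]
  have xF: "x \<in> F" and xmin: "\<And>y. y \<in> F \<Longrightarrow> edge_inner E w x \<le> edge_inner E w y"
    using x by (auto simp: Min_face_def)
  obtain \<S> D where SD: "\<S> \<subseteq> {S. S \<subseteq> V \<and> odd (card S)}" "D \<subseteq> E"
    "F = {x \<in> PM V E. (\<forall>S\<in>\<S>. sum x (cut_edges E S) = 1) \<and> (\<forall>e\<in>D. x e = 0)}"
    using F by (auto simp: is_face_def)
  have PM: "x \<in> PM V E" using xF SD(3) by auto
  define E' where "E' = {e \<in> E. 0 < x e}"
  note fp = frac_pm_support[OF G PM, folded E'_def]
  obtain M where M: "M \<subseteq> E'" "e \<in> M"
    "\<And>S. tight_odd edge_fst edge_snd V E' x S \<Longrightarrow> card (M \<inter> bcut edge_fst edge_snd E' S) = 1"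
    using edmonds_matching_through_edge[OF fp(1), of e] e by (auto simp: pm_through_def E'_def)
  have card1: "card (M \<inter> cut_edges E S) = 1" if "S \<subseteq> V" "odd (card S)" "sum x (cut_edges E S) = 1" for S
  proof -
    have "M \<inter> cut_edges E S = M \<inter> bcut edge_fst edge_snd E' S"
      unfolding cb using M(1) by (auto simp: bcut_def E'_def)
    then show ?thesis using M(3)[of S] that fp(2)[of S] by (simp add: tight_odd_def)
  qed
  have sumM: "sum (indicator M) (cut_edges E S) = real (card (M \<inter> cut_edges E S))" for S
    using fin by (intro sum_indicator_card) (simp add: cut_edges_def)
  have deg: "card (M \<inter> cut_edges E {v}) = 1" if "v \<in> V" for v
    using card1[of "{v}"] that PM by (auto simp: PM_def)
  have ME: "M \<subseteq> E" using M(1) by (auto simp: E'_def)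
  have pm: "perfect_matching V E M"
    unfolding perfect_matching_def
  proof (intro conjI ballI ME)
    fix v assume "v \<in> V"
    then obtain f where f: "M \<inter> cut_edges E {v} = {f}"
      using deg by (metis card_1_singletonE)
    have "M \<inter> cut_edges E {v} = {e \<in> M. v \<in> e}"
      using ME by (auto simp: cut_edges_def Int_insert_right split: if_splits)
    then have "{e \<in> M. v \<in> e} = {f}" using f by simp
    then have "e \<in> M \<and> v \<in> e \<longleftrightarrow> e = f" for e by (simp only: set_eq_iff mem_Collect_eq singleton_iff)
    then show "\<exists>!e. e \<in> M \<and> v \<in> e" by simp
  qed
  \<comment> \<open>The tight cuts are known already. For the others parity suffices: a matching
    that misses the cut would pair up the vertices of \<open>S\<close>.\<close>
  have odd_cut: "1 \<le> card (M \<inter> cut_edges E S)" if S: "S \<subseteq> V" "odd (card S)" for S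
  proof (rule ccontr)
    assume "\<not> ?thesis"
    then have "card (M \<inter> cut_edges E S) = 0" by simp
    moreover have "finite S" using S(1) fin(1) by (rule finite_subset)
    then have "(\<Sum>v\<in>S. sum (indicator M) (cut_edges E {v})) = real (card (M \<inter> cut_edges E S)) +
        2 * real (card (M \<inter> {e \<in> E. edge_fst e \<in> S \<and> edge_snd e \<in> S}))"
      using sum_bcut_singletons[of E S edge_fst edge_snd "indicator M"] fin ends
      unfolding cb[symmetric] sumM by (subst (asm) sum_indicator_card) auto
    moreover have "(\<Sum>v\<in>S. sum (indicator M) (cut_edges E {v})) = real (card S)"
      unfolding sumM using deg S by (simp add: subset_iff)
    ultimately have "real (card S) = real (2 * card (M \<inter> {e \<in> E. edge_fst e \<in> S \<and> edge_snd e \<in> S}))"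
      by simp
    then have "card S = 2 * card (M \<inter> {e \<in> E. edge_fst e \<in> S \<and> edge_snd e \<in> S})"
      by (simp only: of_nat_eq_iff)
    then show False using S by simp
  qed
  have MPM: "indicator M \<in> PM V E"
    unfolding PM_def using deg odd_cut ME by (auto simp: sumM indicator_eq_0_iff)
  have MF: "indicator M \<in> F"
  proof -
    have "sum (indicator M) (cut_edges E S) = (1::real)" if "S \<in> \<S>" for S
      unfolding sumM using card1[of S] that SD xF by auto
    moreover have "indicator M e = (0::real)" if "e \<in> D" for e
      using that SD xF M(1) by (auto simp: E'_def indicator_def)
    ultimately show ?thesis using MPM SD(3) by auto
  qed
  define z where "z = (\<lambda>e. x e - indicator M e)"
  have "\<exists>\<epsilon>>0. (\<lambda>e. x e + \<epsilon> * z e) \<in> F"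
  proof (rule face_perturb[OF G F xF])
    fix f assume "z f \<noteq> 0"
    then show "f \<in> E \<and> 0 < x f"
      using PM M(1) by (cases "f \<in> M") (auto simp: z_def E'_def PM_def order.strict_iff_order)
  next
    fix S assume "S \<subseteq> V" "odd (card S)" "sum x (cut_edges E S) = 1"
    then show "sum z (cut_edges E S) = 0" using card1[of S] by (simp add: z_def sum_subtractf sumM)
  qed
  then obtain \<epsilon> where \<epsilon>: "\<epsilon> > 0" "(\<lambda>e. x e + \<epsilon> * z e) \<in> F" by auto
  then have "0 \<le> \<epsilon> * edge_inner E w z" using xmin[OF \<epsilon>(2)] by (simp add: edge_inner_combine)
  then have "0 \<le> edge_inner E w z" using \<epsilon>(1) by (simp add: zero_le_mult_iff)
  moreover have "edge_inner E w z = edge_inner E w x - edge_inner E w (indicator M)"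
    by (simp add: z_def edge_inner_def sum_subtractf algebra_simps)
  ultimately have "indicator M \<in> Min_face E F w"
    using MF xmin unfolding Min_face_def by force
  then show ?thesis using pm M(2) by blast
qed

text \<open>Makes the results on \<open>Min_face\<close> available for \<open>F\<close>
  itself.\<close>

lemma Min_face_zero: "Min_face E F (\<lambda>_. 0) = F"
  by (auto simp: Min_face_def edge_inner_def)

lemma edge_inner_eq_0:
  fixes z :: "'a set \<Rightarrow> real"
  assumes G: "simple_graph V E" and F: "is_face V E F" and x: "x \<in> Min_face E F w"
    and supp: "\<And>e. z e \<noteq> 0 \<Longrightarrow> e \<in> E \<and> 0 < x e"
    and tight: "\<And>S. S \<subseteq> V \<Longrightarrow> odd (card S) \<Longrightarrow> sum x (cut_edges E S) = 1 \<Longrightarrow> sum z (cut_edges E S) = 0"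
  shows "edge_inner E w z = 0"
proof -
  have xF: "x \<in> F" and xmin: "\<And>y. y \<in> F \<Longrightarrow> edge_inner E w x \<le> edge_inner E w y"
    using x by (auto simp: Min_face_def)
  have nonneg: "0 \<le> c * edge_inner E w z" if "c \<noteq> 0" for c :: real
  proof -
    have "\<exists>\<epsilon>>0. (\<lambda>e. x e + \<epsilon> * (c * z e)) \<in> F"
      using supp tight by (intro face_perturb[OF G F xF]) (auto simp flip: sum_distrib_left)
    then obtain \<epsilon> where \<epsilon>: "\<epsilon> > 0" "(\<lambda>e. x e + \<epsilon> * c * z e) \<in> F" by (auto simp: mult.assoc)
    then have "0 \<le> \<epsilon> * (c * edge_inner E w z)" using xmin[OF \<epsilon>(2)] by (simp add: edge_inner_combine)
    then show ?thesis using \<epsilon>(1) by (simp add: zero_le_mult_iff)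
  qed
  show ?thesis using nonneg[of 1] nonneg[of "-1"] by simp
qed

section \<open>Relative interior points\<close>

text \<open>Averaging with a witness for one further functional keeps the earlier ones positive, as
  all of them are nonnegative on \<open>K\<close>.\<close>

lemma common_positive_point:
  fixes I :: "(('e \<Rightarrow> real) \<Rightarrow> real) set"
  assumes "finite I" "K \<noteq> {}"
    and mid: "\<And>x y. x \<in> K \<Longrightarrow> y \<in> K \<Longrightarrow> (\<lambda>e. (x e + y e) / 2) \<in> K"
    and aff: "\<And>\<phi> x y. \<phi> \<in> I \<Longrightarrow> \<phi> (\<lambda>e. (x e + y e) / 2) = (\<phi> x + \<phi> y) / 2"
    and nonneg: "\<And>\<phi> x. \<phi> \<in> I \<Longrightarrow> x \<in> K \<Longrightarrow> 0 \<le> \<phi> x"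
    and pos: "\<And>\<phi>. \<phi> \<in> I \<Longrightarrow> \<exists>y\<in>K. 0 < \<phi> y"
  shows "\<exists>x\<in>K. \<forall>\<phi>\<in>I. 0 < \<phi> x"
  using assms(1) aff nonneg pos
proof (induction I rule: finite_induct)
  case empty
  then show ?case using \<open>K \<noteq> {}\<close> by auto
next
  case (insert \<psi> I)
  have "\<exists>x\<in>K. \<forall>\<phi>\<in>I. 0 < \<phi> x"
    by (rule insert.IH; use insert.prems in blast)
  then obtain x where x: "x \<in> K" "\<forall>\<phi>\<in>I. 0 < \<phi> x" by blast
  obtain y where y: "y \<in> K" "0 < \<psi> y" using insert.prems by blast
  let ?m = "\<lambda>e. (x e + y e) / 2"
  have "0 < \<phi> ?m" if "\<phi> \<in> insert \<psi> I" for \<phi>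
  proof -
    have "0 \<le> \<phi> x" "0 \<le> \<phi> y" using insert.prems(2)[OF that] x y by auto
    moreover have "0 < \<phi> x \<or> 0 < \<phi> y" using that x y by auto
    ultimately show ?thesis unfolding insert.prems(1)[OF that, of x y] by (elim disjE) simp_all
  qed
  then show ?case using mid[OF x(1) y(1)] by blast
qed

lemma relative_interior_point:
  assumes G: "simple_graph V E" and F: "is_face V E F" and ne: "Min_face E F w \<noteq> {}"
  defines "F' \<equiv> Min_face E F w"
  obtains x where "x \<in> F'" "\<And>e. e \<in> supp E F' \<longleftrightarrow> e \<in> E \<and> 0 < x e"
    "\<And>S. S \<in> tight V E F' \<longleftrightarrow> S \<subseteq> V \<and> odd (card S) \<and> sum x (cut_edges E S) = 1"
proof -
  note fin = simple_graph_finite[OF G]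
  obtain \<S> D where SD: "F = {x \<in> PM V E. (\<forall>S\<in>\<S>. sum x (cut_edges E S) = 1) \<and> (\<forall>e\<in>D. x e = 0)}"
    using F by (auto simp: is_face_def)
  have PM: "x \<in> PM V E" if "x \<in> F'" for x using that SD by (auto simp: F'_def Min_face_def)
  have sum_mid: "sum (\<lambda>e. (x e + y e) / 2) A = (sum x A + sum y A) / 2" for x y :: "'a set \<Rightarrow> real" and A
    by (simp add: sum.distrib flip: sum_divide_distrib)
  have inner_mid: "edge_inner E w (\<lambda>e. (x e + y e) / 2) = (edge_inner E w x + edge_inner E w y) / 2" for x y
    unfolding edge_inner_def by (simp add: sum.distrib ring_distribs flip: sum_divide_distrib)
  have mid: "(\<lambda>e. (x e + y e) / 2) \<in> F'" if xy: "x \<in> F'" "y \<in> F'" for x y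
  proof -
    have "x \<in> F" "y \<in> F" using xy by (auto simp: F'_def Min_face_def)
    then have "(\<lambda>e. (x e + y e) / 2) \<in> F"
      unfolding SD PM_def by (auto simp: sum_mid) (metis add_mono one_add_one)
    moreover have "edge_inner E w x \<le> edge_inner E w v" "edge_inner E w y \<le> edge_inner E w v" if "v \<in> F" for v
      using xy that by (auto simp: F'_def Min_face_def)
    ultimately show ?thesis by (force simp: F'_def Min_face_def inner_mid)
  qed
  define U where "U = {S. S \<subseteq> V \<and> odd (card S) \<and> S \<notin> tight V E F'}"
  \<comment> \<open>The inequalities that are strict somewhere on the face: the coordinates in its
    support and the slacks of the odd cuts that are not tight.\<close>
  define I where "I = (\<lambda>e x :: 'a set \<Rightarrow> real. x e) ` supp E F' \<union> (\<lambda>S x. sum x (cut_edges E S) - 1) ` U"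
  have "\<exists>x\<in>F'. \<forall>\<phi>\<in>I. 0 < \<phi> x"
  proof (rule common_positive_point)
    show "finite I" using fin unfolding I_def supp_def U_def by auto
    show "F' \<noteq> {}" using ne by (simp add: F'_def)
    show "0 \<le> \<phi> x" if "\<phi> \<in> I" "x \<in> F'" for \<phi> x
      using that PM[of x] by (auto simp: I_def U_def PM_def supp_def)
    show "\<exists>y\<in>F'. 0 < \<phi> y" if "\<phi> \<in> I" for \<phi>
    proof -
      from that consider e where "e \<in> supp E F'" "\<phi> = (\<lambda>x. x e)"
        | S where "S \<in> U" "\<phi> = (\<lambda>x. sum x (cut_edges E S) - 1)" unfolding I_def by blast
      then show ?thesis
      proof cases
        case 2
        then obtain y where y: "y \<in> F'" "sum y (cut_edges E S) \<noteq> 1" by (auto simp: U_def tight_def)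
        moreover have "1 \<le> sum y (cut_edges E S)" using PM[OF y(1)] 2 unfolding U_def PM_def by blast
        ultimately have "1 < sum y (cut_edges E S)" by simp
        then show ?thesis using y 2 by auto
      qed (auto simp: supp_def)
    qed
    show "\<phi> (\<lambda>e. (x e + y e) / 2) = (\<phi> x + \<phi> y) / 2" if "\<phi> \<in> I" for \<phi> x y
      using that unfolding I_def by (auto simp: sum_mid field_simps)
  qed (rule mid)
  then obtain x where x: "x \<in> F'" "\<And>\<phi>. \<phi> \<in> I \<Longrightarrow> 0 < \<phi> x" by blast
  show ?thesis
  proof (rule that[OF x(1)])
    show "e \<in> supp E F' \<longleftrightarrow> e \<in> E \<and> 0 < x e" for e
      using x(1) x(2)[of "\<lambda>x. x e"] by (auto simp: I_def supp_def)
    show "S \<in> tight V E F' \<longleftrightarrow> S \<subseteq> V \<and> odd (card S) \<and> sum x (cut_edges E S) = 1" for S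
    proof
      assume S: "S \<subseteq> V \<and> odd (card S) \<and> sum x (cut_edges E S) = 1"
      show "S \<in> tight V E F'"
      proof (rule ccontr)
        assume "S \<notin> tight V E F'"
        then have "(\<lambda>x. sum x (cut_edges E S) - 1) \<in> I" using S by (auto simp: I_def U_def)
        then show False using x(2) S by force
      qed
    qed (use x(1) in \<open>auto simp: tight_def\<close>)
  qed
qed

section \<open>Lifting circuits of the contraction\<close>

lemma sum_abs_alt_vec_le:
  assumes "finite A"
  shows "(\<Sum>e\<in>A. \<bar>alt_vec es e\<bar>) \<le> int (length es)"
proof (induction es)
  case (Cons x es)
  have "(\<Sum>e\<in>A. \<bar>alt_vec (x # es) e\<bar>) \<le> (\<Sum>e\<in>A. indicator {x} e + \<bar>alt_vec es e\<bar>)"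
    by (intro sum_mono) (auto simp: alt_vec_Cons indicator_def)
  also have "\<dots> = (\<Sum>e\<in>A. indicator {x} e) + (\<Sum>e\<in>A. \<bar>alt_vec es e\<bar>)" by (simp add: sum.distrib)
  also have "(\<Sum>e\<in>A. indicator {x} e) \<le> (1::int)"
    using assms by (subst sum_indicator_card) (auto simp: Int_insert_left)
  finally show ?case using Cons by simp
qed simp

lemma alt_vec_nonzero_in_set: "alt_vec es e \<noteq> 0 \<Longrightarrow> e \<in> set es"
  by (induction es) (auto simp: alt_vec_Cons indicator_def of_bool_def split: if_splits)

section \<open>Nodes and edges of the contraction\<close>

locale contracted_graph =
  fixes V :: "'a set" and E F L and \<beta> :: real and H
  assumes simple: "simple_graph V E" and pair: "face_laminar_pair V E F L" and \<beta>: "1 \<le> \<beta>"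
    and contr: "\<And>S. S \<in> L \<Longrightarrow> real (card S) \<le> \<beta> \<Longrightarrow> contractible V E F S"
    and H: "H = contraction E F L \<beta>"
begin

lemmas fin = simple_graph_finite[OF simple]

lemmas cut_bcut = cut_edges_eq_bcut[OF fin(3), of E, simplified]

lemma face: "is_face V E F" and laminar_L: "laminar V L" and L_tight: "L \<subseteq> tight V E F"
  using pair by (auto simp: face_laminar_pair_def)

lemma finite_cut [simp]: "finite (cut_edges E S)"
  using fin(2) by (simp add: cut_edges_def)

lemma nodes_iff: "S \<in> nodes H \<longleftrightarrow> S \<in> L \<and> real (card S) \<le> \<beta> \<and>
    (\<forall>T\<in>L. real (card T) \<le> \<beta> \<and> S \<subseteq> T \<longrightarrow> T = S)"
  by (simp add: H contraction_def Let_def)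

lemma ends_eq: "ends H e = {S \<in> nodes H. S \<inter> e \<noteq> {}}"
  by (simp add: H contraction_def Let_def)

lemma node_wt_eq: "node_wt H = card"
  by (simp add: H contraction_def Let_def)

lemma edges_H:
  assumes "e \<in> edges H"
  shows "e \<in> supp E F" "e \<in> E" "\<And>S. S \<in> nodes H \<Longrightarrow> \<not> e \<subseteq> S"
  using assms by (auto simp: H contraction_def Let_def supp_def)

lemma node:
  assumes "S \<in> nodes H"
  shows "S \<subseteq> V" "odd (card S)" "S \<in> tight V E F" "contractible V E F S" "finite S"
proof -
  show "S \<in> tight V E F" "contractible V E F S" using assms contr L_tight by (auto simp: nodes_iff)
  then show "S \<subseteq> V" "odd (card S)" by (auto simp: tight_def)
  then show "finite S" using fin(1) finite_subset by blast
qed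

lemma nodes_disjoint:
  assumes "S \<in> nodes H" "T \<in> nodes H" "S \<noteq> T"
  shows "S \<inter> T = {}"
proof (rule ccontr)
  assume "S \<inter> T \<noteq> {}"
  moreover have "\<not> crossing S T" using laminar_L assms by (auto simp: laminar_def nodes_iff)
  ultimately have "S \<subseteq> T \<or> T \<subseteq> S" by (auto simp: crossing_def)
  then show False using assms unfolding nodes_iff by metis
qed

text \<open>Singletons belong to the laminar family and satisfy the size bound because 1 \<le>
  \<beta>; a largest admissible set around \<open>v\<close> is maximal.\<close>

lemma nodes_cover:
  assumes "v \<in> V"
  shows "\<exists>S\<in>nodes H. v \<in> S"
proof -
  define K where "K = {T \<in> L. v \<in> T \<and> real (card T) \<le> \<beta>}"
  have "{v} \<in> K" using assms laminar_L \<beta> by (auto simp: K_def laminar_def)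
  moreover have "K \<subseteq> Pow V" using laminar_L by (auto simp: K_def laminar_def)
  then have "finite K" using fin(1) finite_subset by blast
  ultimately obtain S where S: "S \<in> K" "\<And>T. T \<in> K \<Longrightarrow> card T \<le> card S"
    using finite_has_maximal[of "card ` K"] by (metis (no_types, lifting) empty_iff finite_imageI image_iff linorder_linear)
  have "T = S" if T: "T \<in> L" "real (card T) \<le> \<beta>" "S \<subseteq> T" for T
  proof -
    have "T \<in> K" using T S(1) by (auto simp: K_def)
    moreover have "finite T" using \<open>T \<in> K\<close> \<open>K \<subseteq> Pow V\<close> fin(1) finite_subset by blast
    ultimately show ?thesis using S(2) T(3) card_seteq by metis
  qed
  then have "S \<in> nodes H" "v \<in> S" using S(1) by (auto simp: nodes_iff K_def)
  then show ?thesis by blast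
qed

lemma cut_node_iff:
  assumes "e \<in> edges H" "S \<in> nodes H"
  shows "e \<in> cut_edges E S \<longleftrightarrow> S \<inter> e \<noteq> {}"
proof -
  have "card e = 2" "\<not> e \<subseteq> S" using assms edges_H fin(3) by auto
  then obtain a b where "e = {a, b}" "a \<noteq> b" by (auto simp: card_2_iff)
  then show ?thesis using \<open>\<not> e \<subseteq> S\<close> edges_H(2)[OF assms(1)]
    by (auto simp: cut_edges_def Int_insert_left)
qed

lemma inner_edges_iff: "f \<in> inner_edges E S \<longleftrightarrow> f \<in> E \<and> f \<subseteq> S"
proof -
  have "card (f \<inter> S) = 2 \<longleftrightarrow> f \<subseteq> S" if f: "f \<in> E"
  proof -
    obtain a b where "f = {a, b}" "a \<noteq> b" using fin(3)[OF f] by (auto simp: card_2_iff)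
    then show ?thesis by (auto simp: Int_insert_left)
  qed
  then show ?thesis by (auto simp: inner_edges_def)
qed

lemma cut_edges_cases:
  assumes "f \<in> cut_edges E T"
  shows "f \<in> E" "f \<inter> T \<noteq> {}" "\<not> f \<subseteq> T"
proof -
  show "f \<in> E" using assms by (simp add: cut_edges_def)
  have "card (f \<inter> T) = 1" "card f = 2" using assms fin(3) by (auto simp: cut_edges_def)
  then show "f \<inter> T \<noteq> {}" by auto
  show "\<not> f \<subseteq> T"
  proof
    assume "f \<subseteq> T"
    then have "f \<inter> T = f" by blast
    then show False using \<open>card (f \<inter> T) = 1\<close> \<open>card f = 2\<close> by simp
  qed
qed

lemma cut_edgesI: "f \<in> E \<Longrightarrow> f \<inter> T \<noteq> {} \<Longrightarrow> \<not> f \<subseteq> T \<Longrightarrow> f \<in> cut_edges E T"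
proof -
  assume f: "f \<in> E" "f \<inter> T \<noteq> {}" "\<not> f \<subseteq> T"
  obtain a b where "f = {a, b}" "a \<noteq> b" using fin(3)[OF f(1)] by (auto simp: card_2_iff)
  then show ?thesis using f by (auto simp: cut_edges_def Int_insert_left)
qed

section \<open>The lift of an alternating vector\<close>

text \<open>Taken in \<open>F\<close> and not in a minimum face, so that the lift is fixed before
  the weight is chosen.\<close>

definition matching_of :: "'a set \<Rightarrow> 'a set set" where
  "matching_of e = (SOME M. perfect_matching V E M \<and> indicator M \<in> F \<and> e \<in> M)"

lemma matching_of:
  assumes "e \<in> edges H"
  shows "perfect_matching V E (matching_of e)" "indicator (matching_of e) \<in> F" "e \<in> matching_of e"
proof -
  obtain x where "x \<in> F" "0 < x e" "e \<in> E" using edges_H(1)[OF assms] by (auto simp: supp_def)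
  then have "\<exists>M. perfect_matching V E M \<and> indicator M \<in> F \<and> e \<in> M"
    using perfect_matching_in_Min_face[OF simple face, of x "\<lambda>_. 0" e] by (simp add: Min_face_zero)
  from someI_ex[OF this, folded matching_of_def]
  show "perfect_matching V E (matching_of e)" "indicator (matching_of e) \<in> F" "e \<in> matching_of e"
    by auto
qed

text \<open>By contractibility, the edges chosen here inside the two end nodes of \<open>e\<close> do not depend on
  the choice of \<open>matching_of\<close>.\<close>

definition lift_edge :: "'a set \<Rightarrow> 'a set set" where
  "lift_edge e = {f \<in> matching_of e. f = e \<or> (\<exists>S\<in>nodes H. S \<inter> e \<noteq> {} \<and> f \<subseteq> S)}"

definition lift_vec :: "('a set \<Rightarrow> int) \<Rightarrow> 'a set \<Rightarrow> int" where
  "lift_vec a f = (\<Sum>e\<in>edges H. a e * indicator (lift_edge e) f)"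

lemma finite_edges_H [simp]: "finite (edges H)"
  by (rule finite_subset[OF _ fin(2)]) (use edges_H(2) in blast)

text \<open>Edges added by the lift lie inside nodes, edges of \<open>H\<close> do not. In
  particular a nonzero vector has a nonzero lift.\<close>

lemma lift_vec_edges_H:
  assumes "f \<in> edges H"
  shows "lift_vec a f = a f"
proof -
  have "indicator (lift_edge e) f = (if e = f then 1 else 0 :: int)" if "e \<in> edges H" for e
    using edges_H(3)[OF assms] matching_of(3)[OF that] by (auto simp: lift_edge_def indicator_def)
  then have "lift_vec a f = (\<Sum>e\<in>edges H. if e = f then a e else 0)"
    unfolding lift_vec_def by (intro sum.cong) auto
  then show ?thesis using assms by simp
qed

lemma abs_lift_vec_le: "\<bar>lift_vec a f\<bar> \<le> (\<Sum>e\<in>edges H. \<bar>a e\<bar>)"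
proof -
  have "\<bar>lift_vec a f\<bar> \<le> (\<Sum>e\<in>edges H. \<bar>a e * indicator (lift_edge e) f\<bar>)"
    unfolding lift_vec_def by (rule sum_abs)
  also have "\<dots> \<le> (\<Sum>e\<in>edges H. \<bar>a e\<bar>)"
    by (intro sum_mono) (auto simp: indicator_def abs_mult)
  finally show ?thesis .
qed

lemma sum_lift_vec:
  "sum (lift_vec a) (cut_edges E T) = (\<Sum>e\<in>edges H. a e * int (card (lift_edge e \<inter> cut_edges E T)))"
proof -
  have "sum (lift_vec a) (cut_edges E T) =
      (\<Sum>e\<in>edges H. \<Sum>f\<in>cut_edges E T. a e * indicator (lift_edge e) f)"
    unfolding lift_vec_def by (rule sum.swap)
  then show ?thesis by (simp add: sum_indicator_card flip: sum_distrib_left)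
qed

context
  fixes w :: "'a set \<Rightarrow> real" and a :: "'a set \<Rightarrow> int"
  assumes a_edges: "\<And>e. a e \<noteq> 0 \<Longrightarrow> e \<in> edges H"
    and resp: "respects_face V E H (Min_face E F w) a"
begin

abbreviation "F' \<equiv> Min_face E F w"

lemma tight_mono: "tight V E F \<subseteq> tight V E F'"
  by (auto simp: tight_def Min_face_def)

lemma resp_union:
  assumes "T \<in> tight V E F'" "\<N> \<subseteq> nodes H" "T = \<Union>\<N>"
  shows "(\<Sum>e\<in>edges H. a e * of_bool (e \<in> cut_edges E T)) = 0"
proof -
  have "0 = edge_inner E a (indicator (cut_edges E T))"
    using resp assms unfolding respects_face_def by auto
  also have "\<dots> = (\<Sum>e\<in>edges H. a e * indicator (cut_edges E T) e)"
    unfolding edge_inner_def using a_edges edges_H(2) fin(2)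
    by (intro sum.mono_neutral_right) auto
  finally show ?thesis by (simp add: indicator_def)
qed

text \<open>A matching through \<open>e\<close> in the minimum face also lies in \<open>F\<close>,
  so contractibility forces it to agree with \<open>matching_of e\<close> inside the end nodes. This
  carries tightness for the minimum face over to \<open>lift_edge e\<close>.\<close>

lemma matching_of_Min_face:
  assumes "a e \<noteq> 0"
  obtains M where "perfect_matching V E M" "indicator M \<in> F'" "e \<in> M"
    "\<forall>S\<in>nodes H. S \<inter> e \<noteq> {} \<longrightarrow> M \<inter> inner_edges E S = matching_of e \<inter> inner_edges E S"
    "lift_edge e \<subseteq> M"
proof -
  have e: "e \<in> edges H" using a_edges assms .
  have "e \<in> supp E F'" using resp assms by (auto simp: respects_face_def)
  then obtain x where "x \<in> F'" "0 < x e" "e \<in> E" by (auto simp: supp_def)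
  then obtain M where M: "perfect_matching V E M" "indicator M \<in> F'" "e \<in> M"
    using perfect_matching_in_Min_face[OF simple face] by blast
  then have MF: "indicator M \<in> F" by (simp add: Min_face_def)
  have same: "M \<inter> inner_edges E S = matching_of e \<inter> inner_edges E S"
    if S: "S \<in> nodes H" "S \<inter> e \<noteq> {}" for S
  proof -
    have "e \<in> cut_edges E S" using S cut_node_iff[OF e] by simp
    then show ?thesis
      using node(4)[OF S(1)] M(1,3) MF matching_of[OF e] unfolding contractible_def by blast
  qed
  moreover have "lift_edge e \<subseteq> M"
  proof
    fix f assume f: "f \<in> lift_edge e"
    show "f \<in> M"
    proof (cases "f = e")
      case False
      then obtain S where S: "f \<in> matching_of e" "S \<in> nodes H" "S \<inter> e \<noteq> {}" "f \<subseteq> S"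
        using f by (auto simp: lift_edge_def)
      moreover have "f \<in> E" using S(1) matching_of(1)[OF e] by (auto simp: perfect_matching_def)
      ultimately show ?thesis using same[OF S(2,3)] by (auto simp: inner_edges_iff)
    qed (use M in simp)
  qed
  ultimately show ?thesis using that[OF M] by blast
qed

lemma matching_tight_cut:
  assumes "indicator M \<in> F'" "T \<in> tight V E F'"
  shows "card (M \<inter> cut_edges E T) = 1"
proof -
  have "sum (indicator M) (cut_edges E T) = (1::real)" using assms by (auto simp: tight_def)
  then show ?thesis by (simp add: sum_indicator_card)
qed

lemma lift_vec_supp:
  assumes "lift_vec a f \<noteq> 0"
  shows "f \<in> supp E F'"
proof -
  obtain e where "a e * indicator (lift_edge e) f \<noteq> 0"
    using assms unfolding lift_vec_def by (meson sum.neutral)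
  then have "a e \<noteq> 0" "f \<in> lift_edge e" by (auto simp: indicator_def split: if_splits)
  obtain M where M: "perfect_matching V E M" "indicator M \<in> F'" "lift_edge e \<subseteq> M"
    by (rule matching_of_Min_face[OF \<open>a e \<noteq> 0\<close>])
  then have "f \<in> M" using \<open>f \<in> lift_edge e\<close> by blast
  then have "f \<in> E" "(0::real) < indicator M f" using M(1) by (auto simp: perfect_matching_def)
  then show ?thesis using M(2) unfolding supp_def by blast
qed

lemma lift_edge_cut_union:
  assumes "e \<in> edges H" "\<N> \<subseteq> nodes H"
  shows "lift_edge e \<inter> cut_edges E (\<Union>\<N>) = {e} \<inter> cut_edges E (\<Union>\<N>)"
proof -
  have "f = e" if f: "f \<in> lift_edge e" "f \<in> cut_edges E (\<Union>\<N>)" for f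
  proof (rule ccontr)
    assume "f \<noteq> e"
    then obtain S where S: "S \<in> nodes H" "f \<subseteq> S" using f(1) by (auto simp: lift_edge_def)
    show False
    proof (cases "S \<in> \<N>")
      case True
      then show False using S cut_edges_cases(3)[OF f(2)] by blast
    next
      case False
      then have "S \<inter> \<Union>\<N> = {}" using nodes_disjoint[OF S(1)] assms(2) by blast
      then show False using S cut_edges_cases(2)[OF f(2)] by blast
    qed
  qed
  moreover have "e \<in> lift_edge e" using matching_of(3)[OF assms(1)] by (simp add: lift_edge_def)
  ultimately show ?thesis by auto
qed

lemma sum_lift_vec_union:
  assumes "T \<in> tight V E F'" "\<N> \<subseteq> nodes H" "T = \<Union>\<N>"
  shows "sum (lift_vec a) (cut_edges E T) = 0"
proof -
  have "sum (lift_vec a) (cut_edges E T) = (\<Sum>e\<in>edges H. a e * of_bool (e \<in> cut_edges E T))"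
    unfolding sum_lift_vec assms(3)
    by (intro sum.cong) (auto simp: lift_edge_cut_union[OF _ assms(2)])
  then show ?thesis using resp_union[OF assms] by simp
qed

text \<open>For an edge \<open>e\<close> at \<open>S\<close>, a matching through \<open>e\<close> in
  the minimum face crosses \<open>S\<close> only in \<open>e\<close>; so its unique edge across
  \<open>T\<close> is \<open>e\<close> or lies inside \<open>S\<close>, and belongs to
  \<open>lift_edge e\<close>. Edges away from \<open>S\<close> contribute nothing. The count is thus
  the same as for the cut of \<open>S\<close>, which the vector respects.\<close>

lemma sum_lift_vec_inside:
  assumes T: "T \<in> tight V E F'" and S: "S \<in> nodes H" "T \<subseteq> S"
  shows "sum (lift_vec a) (cut_edges E T) = 0"
proof -
  have count: "card (lift_edge e \<inter> cut_edges E T) = of_bool (e \<in> cut_edges E S)" if ae: "a e \<noteq> 0" for e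
  proof -
    have e: "e \<in> edges H" using a_edges ae .
    show ?thesis
    proof (cases "S \<inter> e = {}")
      case True
      have "f \<notin> cut_edges E T" if fl: "f \<in> lift_edge e" for f
      proof
        assume f: "f \<in> cut_edges E T"
        show False
        proof (cases "f = e")
          case True
          then show False using cut_edges_cases(2)[OF f] S \<open>S \<inter> e = {}\<close> by blast
        next
          case False
          then obtain S' where S': "S' \<in> nodes H" "S' \<inter> e \<noteq> {}" "f \<subseteq> S'"
            using fl by (auto simp: lift_edge_def)
          then have "S' \<inter> S = {}" using nodes_disjoint S(1) \<open>S \<inter> e = {}\<close> by metis
          then show False using cut_edges_cases(2)[OF f] S S' by blast
        qed
      qed
      then have "lift_edge e \<inter> cut_edges E T = {}" by blast
      then show ?thesis using True cut_node_iff[OF e S(1)] by simp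
    next
      case False
      obtain M where M: "perfect_matching V E M" "indicator M \<in> F'" "e \<in> M"
        "\<forall>S\<in>nodes H. S \<inter> e \<noteq> {} \<longrightarrow> M \<inter> inner_edges E S = matching_of e \<inter> inner_edges E S"
        "lift_edge e \<subseteq> M"
        by (rule matching_of_Min_face[OF ae])
      have "S \<in> tight V E F'" using node(3)[OF S(1)] tight_mono by blast
      then obtain g where g: "M \<inter> cut_edges E S = {g}"
        using matching_tight_cut[OF M(2)] by (metis card_1_singletonE)
      have ecut: "e \<in> cut_edges E S" using False cut_node_iff[OF e S(1)] by simp
      then have g: "M \<inter> cut_edges E S = {e}" using g M(3) by blast
      have "f \<in> lift_edge e" if f: "f \<in> M" "f \<in> cut_edges E T" for f
      proof (cases "f \<subseteq> S")
        case True
        then have "f \<in> M \<inter> inner_edges E S" using f cut_edges_cases(1) by (auto simp: inner_edges_iff)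
        then have "f \<in> matching_of e" using M(4) S(1) False by blast
        then show ?thesis using True False S(1) by (auto simp: lift_edge_def)
      next
        case f2: False
        have "f \<in> cut_edges E S"
          using cut_edges_cases[OF f(2)] f2 S(2) by (intro cut_edgesI) auto
        then have "f = e" using f(1) g by blast
        then show ?thesis using matching_of(3)[OF e] by (simp add: lift_edge_def)
      qed
      then have "lift_edge e \<inter> cut_edges E T = M \<inter> cut_edges E T" using M(5) by blast
      then show ?thesis using matching_tight_cut[OF M(2) T] ecut by simp
    qed
  qed
  have "a e * int (card (lift_edge e \<inter> cut_edges E T)) = a e * of_bool (e \<in> cut_edges E S)" for e
    using count[of e] by (cases "a e = 0") simp_all
  then have "sum (lift_vec a) (cut_edges E T) = (\<Sum>e\<in>edges H. a e * of_bool (e \<in> cut_edges E S))"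
    unfolding sum_lift_vec by (simp only:)
  also have "\<dots> = 0"
    using resp_union[of S "{S}"] node(3)[OF S(1)] tight_mono S(1) by auto
  finally show ?thesis .
qed

lemma edge_inner_lift_vec:
  assumes "a \<noteq> (\<lambda>e. 0)"
  shows "edge_inner E w (\<lambda>e. real_of_int (lift_vec a e)) = 0"
proof -
  obtain e where "a e \<noteq> 0" using assms by auto
  then have "e \<in> supp E F'" using resp by (auto simp: respects_face_def)
  then have "F' \<noteq> {}" by (auto simp: supp_def)
  then obtain x where x: "x \<in> F'" "\<And>e. e \<in> supp E F' \<longleftrightarrow> e \<in> E \<and> 0 < x e"
    "\<And>S. S \<in> tight V E F' \<longleftrightarrow> S \<subseteq> V \<and> odd (card S) \<and> sum x (cut_edges E S) = 1"
    using relative_interior_point[OF simple face] by blast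
  have "x \<in> PM V E" using x(1) face by (auto simp: Min_face_def is_face_def)
  define E' where "E' = {e \<in> E. 0 < x e}"
  note fp = frac_pm_support[OF simple \<open>x \<in> PM V E\<close>, folded E'_def]
  let ?tight = "tight_odd edge_fst edge_snd V E' x" and ?cut = "bcut edge_fst edge_snd E'"
  have tight_iff: "?tight T \<longleftrightarrow> T \<in> tight V E F'" for T
    unfolding tight_odd_def fp(2) x(3) ..
  \<comment> \<open>The lift vanishes outside the support of the minimum face, so the emptiness
    statements of \<open>tight_odd_uncross\<close>, which concern \<open>E'\<close>, remove the
    correction terms for the lift too.\<close>
  have cut_eq: "sum (lift_vec a) (?cut T) = sum (lift_vec a) (cut_edges E T)" for T
    unfolding cut_bcut using fin(2) lift_vec_supp x(2)
    by (intro sum.mono_neutral_left) (auto simp: bcut_def E'_def)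
  have "finite E'" using fin(2) by (simp add: E'_def)
  note unc = sum_bcut_uncross_Int_Un[OF this, of "lift_vec a" edge_fst edge_snd]
    sum_bcut_uncross_Diff[OF this, of "lift_vec a" edge_fst edge_snd]
  \<comment> \<open>The nodes met by \<open>T\<close> but not contained in it; their number is the
    induction measure.\<close>
  define split where "split T = {S \<in> nodes H. S \<inter> T \<noteq> {} \<and> S - T \<noteq> {}}" for T
  have fin_nodes: "finite (nodes H)" using node(1) fin(1) finite_subset[of "nodes H" "Pow V"] by auto
  have zero: "sum (lift_vec a) (?cut T) = 0" if "?tight T" for T
    using that
  proof (induction "card (split T)" arbitrary: T rule: less_induct)
    case less
    have TV: "T \<subseteq> V" "T \<in> tight V E F'"
      using less.prems tight_iff[of T] by (auto simp: tight_odd_def)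
    consider "split T = {}" | S where "S \<in> nodes H" "T \<subseteq> S"
      | S where "S \<in> split T" "\<not> T \<subseteq> S" by (auto simp: split_def)
    then show ?case
    proof cases
      case 1
      have "T = \<Union>{S \<in> nodes H. S \<inter> T \<noteq> {}}"
      proof
        show "T \<subseteq> \<Union>{S \<in> nodes H. S \<inter> T \<noteq> {}}"
        proof
          fix v assume "v \<in> T"
          moreover obtain S where "S \<in> nodes H" "v \<in> S" using nodes_cover[of v] TV(1) \<open>v \<in> T\<close> by auto
          ultimately show "v \<in> \<Union>{S \<in> nodes H. S \<inter> T \<noteq> {}}" by auto
        qed
        show "\<Union>{S \<in> nodes H. S \<inter> T \<noteq> {}} \<subseteq> T" using 1 by (auto simp: split_def)
      qed
      then show ?thesis unfolding cut_eq using sum_lift_vec_union[OF TV(2), of "{S \<in> nodes H. S \<inter> T \<noteq> {}}"] by blast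
    next
      case 2
      then show ?thesis unfolding cut_eq using sum_lift_vec_inside[OF TV(2)] by blast
    next
      case (3 S)
      then have S: "S \<in> nodes H" "S \<inter> T \<noteq> {}" "S - T \<noteq> {}" by (auto simp: split_def)
      have S_tight: "?tight S" using node(3)[OF S(1)] tight_mono tight_iff by blast
      have S0: "sum (lift_vec a) (?cut U) = 0" if "U \<subseteq> S" "?tight U" for U
        unfolding cut_eq using sum_lift_vec_inside[OF _ S(1) that(1)] that(2) tight_iff by blast
      \<comment> \<open>Applied to \<open>S \<union> T\<close> and \<open>T - S\<close>: neither
        splits \<open>S\<close>, and both agree with \<open>T\<close> on all other nodes. The second
        set produced by uncrossing lies inside \<open>S\<close>.\<close>
      have smaller: "card (split U) < card (split T)"
        if U: "S \<notin> split U" "\<And>S'. S' \<in> nodes H \<Longrightarrow> S' \<inter> S = {} \<Longrightarrow> S' \<inter> U = S' \<inter> T" for U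
      proof (rule psubset_card_mono)
        show "finite (split T)" using fin_nodes by (simp add: split_def)
        have "S' \<in> split T" if S': "S' \<in> split U" for S'
        proof -
          have "S' \<in> nodes H" "S' \<noteq> S" using S' U(1) by (auto simp: split_def)
          then have "S' \<inter> U = S' \<inter> T" using U(2) nodes_disjoint S(1) by blast
          then show ?thesis using S' unfolding split_def by blast
        qed
        then show "split U \<subset> split T" using U(1) 3(1) by blast
      qed
      show ?thesis
      proof (cases "odd (card (S \<inter> T))")
        case True
        note u = tight_odd_uncross(1)[OF fp(1) S_tight less.prems True]
        have "sum (lift_vec a) (?cut (S \<union> T)) = 0"
          using u by (intro less.hyps smaller) (auto simp: split_def)
        then show ?thesis
          using unc(1)[of S T] u[THEN conjunct1] S0[of S] S0[of "S \<inter> T"] S_tight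
          unfolding u[THEN conjunct2, THEN conjunct2] by simp
      next
        case False
        then have even: "even (card (S \<inter> T))" by simp
        note u = tight_odd_uncross(2)[OF fp(1) S_tight less.prems even]
        have "sum (lift_vec a) (?cut (T - S)) = 0"
          using u by (intro less.hyps smaller) (auto simp: split_def)
        then show ?thesis
          using unc(2)[of S T] u[THEN conjunct1] S0[of S] S0[of "S - T"] S_tight
          unfolding u[THEN conjunct2, THEN conjunct2] by simp
      qed
    qed
  qed
  show ?thesis
  proof (rule edge_inner_eq_0[OF simple face x(1)])
    show "e \<in> E \<and> 0 < x e" if "real_of_int (lift_vec a e) \<noteq> 0" for e
      using lift_vec_supp[of e] that x(2) by simp
    show "(\<Sum>e\<in>cut_edges E S. real_of_int (lift_vec a e)) = 0"
      if "S \<subseteq> V" "odd (card S)" "sum x (cut_edges E S) = 1" for S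
    proof -
      have "?tight S" using that tight_iff x(3) by blast
      then have "sum (lift_vec a) (cut_edges E S) = 0" using zero cut_eq by metis
      then show ?thesis by (simp flip: of_int_sum)
    qed
  qed
qed

end

text \<open>An ordered pair of vertices determines the arc: the edge they form and the nodes
  containing them.\<close>

lemma card_arcs_le: "finite (arcs H)" "card (arcs H) \<le> (card V)\<^sup>2"
proof -
  define nd where "nd v = (SOME S. S \<in> nodes H \<and> v \<in> S)" for v
  have nd: "nd v \<in> nodes H" "v \<in> nd v" if "v \<in> V" for v
    using someI_ex[of "\<lambda>S. S \<in> nodes H \<and> v \<in> S"] nodes_cover[OF that] unfolding nd_def by blast+
  let ?g = "\<lambda>(p, q). (nd p, {p, q}, nd q)"
  have "arcs H \<subseteq> ?g ` (V \<times> V)"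
  proof
    fix r assume "r \<in> arcs H"
    then obtain u f v where r: "r = (u, f, v)" "f \<in> edges H" "ends H f = {u, v}"
      by (auto simp: arcs_def)
    obtain p q where pq: "f = {p, q}" "p \<noteq> q" using fin(3)[OF edges_H(2)[OF r(2)]] by (auto simp: card_2_iff)
    have V: "p \<in> V" "q \<in> V" using fin(4)[OF edges_H(2)[OF r(2)]] pq by auto
    have "nd p \<noteq> nd q" using edges_H(3)[OF r(2) nd(1)[OF V(1)]] nd V pq by auto
    moreover have "nd p \<in> {u, v}" "nd q \<in> {u, v}"
      unfolding r(3)[symmetric] ends_eq using nd V pq by auto
    ultimately have "u = nd p \<and> v = nd q \<or> u = nd q \<and> v = nd p" by auto
    then have "r = ?g (p, q) \<or> r = ?g (q, p)" using r(1) pq(1) by auto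
    then show "r \<in> ?g ` (V \<times> V)" using V by blast
  qed
  moreover have "finite (V \<times> V)" using fin(1) by simp
  ultimately show "finite (arcs H)" "card (arcs H) \<le> (card V)\<^sup>2"
    using surj_card_le[of "V \<times> V" "arcs H" ?g] finite_subset[of "arcs H"]
    by (auto simp: card_cartesian_product power2_eq_square)
qed

lemma card_E_le: "card E \<le> (card V)\<^sup>2"
proof -
  have "E \<subseteq> (\<lambda>(p, q). {p, q}) ` (V \<times> V)"
  proof
    fix e assume "e \<in> E"
    then obtain p q where "e = {p, q}" using fin(3)[of e] by (auto simp: card_2_iff)
    then show "e \<in> (\<lambda>(p, q). {p, q}) ` (V \<times> V)" using fin(4)[OF \<open>e \<in> E\<close>] by auto
  qed
  then show ?thesis using surj_card_le[of "V \<times> V" E "\<lambda>(p, q). {p, q}"] fin(1)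
    by (simp add: card_cartesian_product power2_eq_square)
qed

lemma length_le_walk_weight:
  assumes "cyclic_walk H vs es"
  shows "length es \<le> walk_weight H vs"
proof -
  have "1 \<le> card S" if "S \<in> set vs" for S
  proof -
    have "S \<in> nodes H" using assms that by (auto simp: cyclic_walk_def)
    then show ?thesis using node(2)[of S] by (cases "card S") auto
  qed
  then have "\<forall>S\<in>set vs. 1 \<le> card S" by blast
  then have "length vs \<le> sum_list (map card vs)" by (induction vs) auto
  then show ?thesis using assms by (simp add: cyclic_walk_def walk_weight_def node_wt_eq)
qed

end

section \<open>Numerical bounds and the choice of the modulus\<close>

lemma base_le_power: "16 \<le> n \<Longrightarrow> 4 * n\<^sup>2 + 1 \<le> (2::nat) ^ n"
proof (induction n rule: nat_induct_at_least)
  case (Suc n)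
  have "16 * n \<le> n\<^sup>2" using Suc.hyps by (simp add: power2_eq_square)
  moreover have "4 * (m + 2 * n + 1) + 1 \<le> 2 * (4 * m + 1)" if "16 * n \<le> m" for m
    using that Suc.hyps by simp
  moreover have "(Suc n)\<^sup>2 = n\<^sup>2 + 2 * n + 1" by (simp add: power2_eq_square)
  ultimately have "4 * (Suc n)\<^sup>2 + 1 \<le> 2 * (4 * n\<^sup>2 + 1)" by simp
  also have "\<dots> \<le> 2 ^ Suc n" using Suc.IH by simp
  finally show ?case .
qed simp

text \<open>The left product is at most 2048 n^17, and n \<ge> 16 gives n^3 \<ge> 4096; this fixes
  the threshold 16 for n.\<close>

lemma isolation_parameters:
  fixes n :: nat
  assumes "16 \<le> n"
  shows "8 * (2 * n\<^sup>2) ^ 7 * (n * Suc (n\<^sup>2)) + 2 < n ^ 20"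
proof -
  have "1 \<le> n\<^sup>2" using assms by simp
  then have "n * Suc (n\<^sup>2) \<le> n * (2 * n\<^sup>2)" by (intro mult_left_mono) auto
  then have "8 * (2 * n\<^sup>2) ^ 7 * (n * Suc (n\<^sup>2)) \<le> 8 * (2 * n\<^sup>2) ^ 7 * (n * (2 * n\<^sup>2))"
    by (rule mult_left_mono) simp
  also have "\<dots> = 2048 * n ^ 17"
    by (simp add: power_mult_distrib flip: power_mult power_Suc power_add)
  finally have "8 * (2 * n\<^sup>2) ^ 7 * (n * Suc (n\<^sup>2)) \<le> 2048 * n ^ 17" .
  moreover have "4096 * n ^ 17 \<le> n ^ 20"
  proof -
    have "16 ^ 3 \<le> n ^ 3" using assms by (rule power_mono) simp
    then have "16 ^ 3 * n ^ 17 \<le> n ^ 3 * n ^ 17" by (rule mult_right_mono) simp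
    then show ?thesis by (simp flip: power_add)
  qed
  moreover have "1 \<le> n ^ 17" using assms by simp
  ultimately show ?thesis by linarith
qed

text \<open>Each power of the base is congruent mod \<open>k\<close> to the weight of its edge, so
  the sum is congruent to the vanishing inner product.\<close>

lemma dvd_of_weight_inner_zero:
  fixes z :: "'a set \<Rightarrow> int"
  assumes "edge_inner E (weight_fun n idx k) (\<lambda>e. real_of_int (z e)) = 0"
  shows "int k dvd (\<Sum>e\<in>E. z e * (4 * (int n)\<^sup>2 + 1) ^ idx e)"
proof -
  let ?b = "\<lambda>e. (4 * n\<^sup>2 + 1) ^ idx e"
  have "real_of_int (\<Sum>e\<in>E. z e * int (?b e mod k)) = 0"
    using assms by (simp add: edge_inner_def weight_fun_def mult.commute)
  then have 0: "(\<Sum>e\<in>E. z e * int (?b e mod k)) = 0" by (simp only: of_int_eq_0_iff)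
  have "(\<Sum>e\<in>E. z e * (4 * (int n)\<^sup>2 + 1) ^ idx e) =
      (\<Sum>e\<in>E. z e * int (?b e mod k) + int k * (z e * int (?b e div k)))"
  proof (rule sum.cong[OF refl])
    fix e
    have "int (?b e) = int (?b e mod k) + int k * int (?b e div k)"
      by (metis mod_mult_div_eq of_nat_add of_nat_mult)
    moreover have "int (?b e) = (4 * (int n)\<^sup>2 + 1) ^ idx e" by (simp add: add.commute)
    ultimately show "z e * (4 * (int n)\<^sup>2 + 1) ^ idx e =
        z e * int (?b e mod k) + int k * (z e * int (?b e div k))"
      by (metis (no_types, lifting) distrib_left mult.left_commute)
  qed
  also have "\<dots> = int k * (\<Sum>e\<in>E. z e * int (?b e div k))"
    using 0 by (simp only: sum.distrib sum_distrib_left[symmetric])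
  finally show ?thesis by simp
qed

theorem theorem5p1:
  shows "\<forall>\<^sub>F n in sequentially.
    \<forall>(V :: 'a set) E idx F L (\<beta> :: real) (lam :: real) H.
      simple_graph V E \<longrightarrow> card V = n \<longrightarrow> bij_betw idx E {1..card E} \<longrightarrow>
      face_laminar_pair V E F L \<longrightarrow>
      1 \<le> \<beta> \<longrightarrow> \<beta> \<le> 2 * real n \<longrightarrow>
      (\<forall>S\<in>L. real (card S) \<le> \<beta> \<longrightarrow> contractible V E F S) \<longrightarrow>
      H = contraction E F L \<beta> \<longrightarrow>
      1 \<le> lam \<longrightarrow> lam \<le> 2 * real n \<longrightarrow>
      \<not> (\<exists>vs es. alternating_circuit H vs es \<and> real (walk_weight H vs) \<le> lam) \<longrightarrow>
      (\<exists>w\<in>weight_family n idx.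
        \<not> (\<exists>vs es. alternating_circuit H vs es \<and> respects_face V E H (Min_face E F w) (alt_vec es) \<and>
             real (walk_weight H vs) \<le> 2 * lam))"
proof (rule eventually_sequentiallyI[of 16], intro allI impI)
  fix n :: nat and V :: "'a set" and E idx F L and \<beta> lam :: real and H
  assume n: "16 \<le> n" and G: "simple_graph V E" "card V = n" and idx: "bij_betw idx E {1..card E}"
    and pair: "face_laminar_pair V E F L" and \<beta>: "1 \<le> \<beta>"
    and contr: "\<forall>S\<in>L. real (card S) \<le> \<beta> \<longrightarrow> contractible V E F S"
    and H: "H = contraction E F L \<beta>" and lam: "lam \<le> 2 * real n"
    and noc: "\<not> (\<exists>vs es. alternating_circuit H vs es \<and> real (walk_weight H vs) \<le> lam)"
  interpret contracted_graph V E F L \<beta> H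
    using G pair \<beta> contr H by unfold_locales auto
  \<comment> \<open>All circuits within the weight bound, respecting or not: the face to be
    respected is known only after \<open>k\<close> has been chosen.\<close>
  define A where "A = {alt_vec es | vs es. alternating_circuit H vs es \<and> real (walk_weight H vs) \<le> 2 * lam}"
  have noc': "\<not> real (walk_weight H vs) \<le> lam" if "alternating_circuit H vs es" for vs es
    using noc that by blast
  have "1 \<le> n\<^sup>2" using n by simp
  then have A: "finite A" "card A \<le> 8 * (2 * n\<^sup>2) ^ 7"
    using card_alt_vec_le[OF noc' card_arcs_le] G(2) unfolding A_def by auto
  define B where "B = 4 * (int n)\<^sup>2 + 1"
  define \<nu> where "\<nu> a = (\<Sum>e\<in>E. lift_vec a e * B ^ idx e)" for a
  have "0 < B" by (simp add: B_def add_nonneg_pos)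
  have a_supp: "e \<in> edges H" if "alternating_circuit H vs es" "alt_vec es e \<noteq> 0" for vs es e
    using that alt_vec_nonzero_in_set[of es e] by (auto simp: alternating_circuit_def cyclic_walk_def)
  \<comment> \<open>Nodes have weight at least 1, so the length of the circuit, and with it every
    entry of the lift, is at most 2 \<open>lam\<close> \<le> 4n.\<close>
  have small: "\<bar>lift_vec a e\<bar> < B" if "a \<in> A" for a e
  proof -
    obtain vs es where C: "a = alt_vec es" "alternating_circuit H vs es" "real (walk_weight H vs) \<le> 2 * lam"
      using \<open>a \<in> A\<close> by (auto simp: A_def)
    have "\<bar>lift_vec a e\<bar> \<le> int (length es)"
      using abs_lift_vec_le[of a e] sum_abs_alt_vec_le[of "edges H" es] C(1) by simp
    also have "length es \<le> walk_weight H vs"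
      using C(2) by (intro length_le_walk_weight) (auto simp: alternating_circuit_def)
    also have "real (walk_weight H vs) \<le> real (4 * n)" using C(3) lam by simp
    then have "walk_weight H vs \<le> 4 * n" by (simp only: of_nat_le_iff)
    also have "int (4 * n) \<le> 4 * (int n)\<^sup>2" using n by (simp add: power2_eq_square)
    finally show ?thesis by (simp add: B_def)
  qed
  have nz: "\<nu> a \<noteq> 0" if "a \<in> A" for a
    unfolding \<nu>_def
  proof (rule base_expansion_nonzero)
    obtain vs es where C: "a = alt_vec es" "alternating_circuit H vs es"
      using \<open>a \<in> A\<close> by (auto simp: A_def)
    then obtain e where "a e \<noteq> 0" by (auto simp: alternating_circuit_def)
    moreover from this have "e \<in> edges H" using a_supp C by blast
    ultimately show "\<exists>e\<in>E. lift_vec a e \<noteq> 0" using lift_vec_edges_H edges_H(2) by metis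
  qed (use fin(2) idx small[OF that] in \<open>auto simp: bij_betw_def\<close>)
  have bound: "\<bar>\<nu> a\<bar> \<le> 2 ^ (n * Suc (n\<^sup>2))" if "a \<in> A" for a
  proof -
    have "\<bar>\<nu> a\<bar> \<le> B ^ Suc (card E)"
      unfolding \<nu>_def using idx small[OF that] \<open>0 < B\<close> by (intro base_expansion_bound)
    also have "\<dots> \<le> B ^ Suc (n\<^sup>2)"
      using card_E_le G(2) \<open>0 < B\<close> by (intro power_increasing) auto
    also have "B = int (4 * n\<^sup>2 + 1)" by (simp add: B_def)
    also have "int (4 * n\<^sup>2 + 1) ^ Suc (n\<^sup>2) \<le> int (2 ^ n) ^ Suc (n\<^sup>2)"
      using base_le_power[OF n] by (intro power_mono) (simp_all only: of_nat_le_iff of_nat_0_le_iff)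
    also have "\<dots> = 2 ^ (n * Suc (n\<^sup>2))" by (simp only: power_mult of_nat_power of_nat_numeral)
    finally show ?thesis .
  qed
  have "card (\<nu> ` A) * (n * Suc (n\<^sup>2)) + 2 < n ^ 20"
  proof -
    have "card (\<nu> ` A) \<le> 8 * (2 * n\<^sup>2) ^ 7" using card_image_le[OF A(1), of \<nu>] A(2) by linarith
    then have "card (\<nu> ` A) * (n * Suc (n\<^sup>2)) \<le> 8 * (2 * n\<^sup>2) ^ 7 * (n * Suc (n\<^sup>2))"
      by (rule mult_right_mono) simp
    then show ?thesis using isolation_parameters[OF n] by linarith
  qed
  then have "\<exists>k\<in>{2..n ^ 20}. \<forall>b\<in>\<nu> ` A. \<not> int k dvd b"
    using A(1) nz bound by (intro exists_common_nondivisor[of _ "n * Suc (n\<^sup>2)"]) auto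
  then obtain k where k: "k \<in> {2..n ^ 20}" "\<And>a. a \<in> A \<Longrightarrow> \<not> int k dvd \<nu> a" by auto
  show "\<exists>w\<in>weight_family n idx.
        \<not> (\<exists>vs es. alternating_circuit H vs es \<and> respects_face V E H (Min_face E F w) (alt_vec es) \<and>
             real (walk_weight H vs) \<le> 2 * lam)"
  proof (intro bexI notI)
    show "weight_fun n idx k \<in> weight_family n idx" using k(1) by (auto simp: weight_family_def)
    assume "\<exists>vs es. alternating_circuit H vs es \<and>
      respects_face V E H (Min_face E F (weight_fun n idx k)) (alt_vec es) \<and>
      real (walk_weight H vs) \<le> 2 * lam"
    then obtain vs es where C: "alternating_circuit H vs es"
      "respects_face V E H (Min_face E F (weight_fun n idx k)) (alt_vec es)"
      "real (walk_weight H vs) \<le> 2 * lam" by blast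
    have "edge_inner E (weight_fun n idx k) (\<lambda>e. real_of_int (lift_vec (alt_vec es) e)) = 0"
      using a_supp[OF C(1)] C(2)
    proof (rule edge_inner_lift_vec)
      show "alt_vec es \<noteq> (\<lambda>e. 0)" using C(1) unfolding alternating_circuit_def by blast
    qed
    then have "int k dvd \<nu> (alt_vec es)"
      unfolding \<nu>_def B_def by (rule dvd_of_weight_inner_zero)
    moreover have "alt_vec es \<in> A" using C by (auto simp: A_def)
    ultimately show False using k(2) by blast
  qed
qed

end
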